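(* Let $v,\lambda,\mu>0$, $p\in(0,1]$, $D_s=\frac1\mu$ and $\rho=\frac{p\lambda}{\mu}$. Suppose $\rho<1$. For an agent following the random waypoint trajectory under M/D/1 queuing (waypoint intervals $Y_j$ i.i.d. exponential with rate $\lambda$, service times $S_i=D_s$ deterministic, each waypoint update polled independently with probability $p$, first-come-first-served single server in steady state), the Age of Positioning is ${\rm AoP}=p\,\kappa\,\lambda\,\mathbb{E}[Q_i]$, where $$\mathbb{E}[Q_i] =\frac{2v^2}{p\lambda^3} + \frac{2v^2(1-p)}{p^2\lambda^3} + \frac{2v^2 D_s}{p\lambda^2} + \sum_{k=1}^{\infty} p(1-p)^{k-1}\, T(k)$$ (with $0^0=1$), and for each $k\ge1$ $$T(k)=\int_0^\infty\!\!\cdots\!\int_0^\infty \lambda^k\, g(y_1,\dots,y_k)\Big(v^2 \sum_{j=1}^k y_j^2\Big) e^{-\lambda\sum_{j=1}^k y_j}\, dy_1\cdots dy_k,$$ $$g(y_1,\dots,y_k) = \frac{D_s \rho}{2(1-\rho)} +D_s -\sum_{j=1}^k y_j -\mathbf{1}\Big(\sum_{j=1}^k y_j \geq D_s \Big) \int_0^{\sum_{j=1}^k y_j -D_s} \Big(w+D_s-\sum_{j=1}^k y_j\Big)f_W(w)\,dw,$$ where $f_W$ is the probability density function of the waiting time in the M/D/1 queue, obtained by taking the derivative (numerically) of its cumulative distribution function $$F_W(w)=(1-\rho) \sum_{n=0}^{m} e^{p\lambda(w-nD_s)}\,\frac{\left\{-p\lambda(w-nD_s)\right\}^{n}}{n!},\qquad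 m=\left\lfloor\frac{w}{D_s}\right\rfloor .$$
   Context: An agent moves in the plane in successive hops with constant speed $v$; at the end of each hop (a waypoint) it picks a new direction uniformly in $(0,2\pi]$, independently. Waypoints are generated by an arrival process of rate $\lambda$. At each waypoint a position update is generated and, independently of everything else, is transmitted ("polled") with probability $p$ and otherwise discarded. Polled updates enter a single-server first-come-first-served queue with service rate $\mu$ and become available at the central server on departure. Service times are independent of the arrival and polling processes. In the notation A/B/1, A refers to the waypoint generation process before polling and B to the service process. Let $X_i$ be the time between the $(i-1)$-th and the $i$-th polled updates. Then $X_i=\sum_{j=1}^{k}Y_j$, where $Y_1,\dots,Y_k$ are the durations of the successive hops between these two polled updates and $k$ is the number of such hops, geometric with $\Pr(k=n)=p(1-p)^{n-1}$, $n\ge 1$, independent of the $Y_j$. For M arrivals the $Y_j$ are i.i.d. exponential with rate $\lambda$. Let $S_i$ be the service time of the $i$-th polled update (for D service: $S_i=D_s=1/\mu$) and let $T_i=W_i+S_i$ be its total time in the system, with waiting time $W_i=(T_{i-1}-X_i)^+$. The queue is in steady state, so $T_{i-1}$ has the stationary system-time distribution and is independent of $X_i$ and its hop durations. The functions $F_W$ and $f_W$ in the claim are the cumulative distribution function and the probability density function (the derivative of $F_W$) of the stationary waiting time in the M/D/1 queue with arrival rate $p\lambda$ and service time $D_s$. $\mathbf{1}(\cdot)$ denotes the indicator function. The position error bound of the position estimate computed from the last available update, after hops of durations $\delta_1,\dots,\delta_h$ since that update was generated, is ${\rm PEB}={\rm PEB}_{\rm o}+\kappa\sum_{l=1}^{h}v^2\delta_l^2$,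 where ${\rm PEB}_{\rm o}$ is the bound at the instant the update was generated; $\kappa=1$ in the motion agnostic mode and $\kappa=\epsilon^2/3$ in the dead-reckoning aided mode (direction sensor errors uniform on $(-\epsilon,\epsilon)$, $\epsilon$ small). The Age of Positioning (AoP) is the time average of ${\rm PEB}(t)-{\rm PEB}_{\rm o}$ over the observation interval; it is expressed as (and may be taken here to be defined by) $${\rm AoP}=p\,\kappa\,\lambda\,\mathbb{E}[Q_i],\qquad Q_i=G_1+G_2+G_3,$$ $$G_1=\sum_{j=1}^{k}\frac{v^2}{3}Y_j^3,\qquad G_2=\sum_{j=1}^{k}Y_j\Big(\sum_{l=1}^{j-1}v^2Y_l^2\Big),\qquad G_3=H_iT_i,\qquad H_i=\sum_{j=1}^{k}v^2Y_j^2 .$$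
   Formalization: The waiting time has an atom of mass 1−ρ at 0, so the integral against f_W is formalized with an added term F_W(0) times the integrand at w=0; with f_W read only as the ordinary derivative of F_W, the stated formula for E[Q_i] is false. *)

theory Defs
  imports "HOL-Probability.Probability"
begin

text \<open>
  Independence of two random variables with possibly different value types;
  \<open>prob_space.indep_var\<close> needs equal types and is characterised in the same way by
  \<open>prob_space.indep_var_distribution_eq\<close>.
\<close>

definition indep_rv ::
    "'a measure \<Rightarrow> 'b measure \<Rightarrow> ('a \<Rightarrow> 'b) \<Rightarrow> 'c measure \<Rightarrow> ('a \<Rightarrow> 'c) \<Rightarrow> bool" where
  "indep_rv M S A T B \<longleftrightarrow> A \<in> measurable M S \<and> B \<in> measurable M T \<and>
     distr M (S \<Otimes>\<^sub>M T) (\<lambda>\<omega>. (A \<omega>, B \<omega>)) = distr M S A \<Otimes>\<^sub>M distr M T B"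

text \<open>
  One polling cycle: \<open>K \<omega>\<close> is the number of hops between two successive polled updates,
  \<open>Y 1 \<omega>, Y 2 \<omega>, \<dots>\<close> are the hop durations (only the first \<open>K \<omega>\<close> belong to the cycle), and
  \<open>U \<omega>\<close> is the system time of the polled update that opens the cycle (so \<open>U\<close> is $T_{i-1}$
  when the functions below are $X_i$, $W_i$, $T_i$, $H_i$, $Q_i$).
\<close>

definition interarrival :: "('a \<Rightarrow> nat) \<Rightarrow> (nat \<Rightarrow> 'a \<Rightarrow> real) \<Rightarrow> 'a \<Rightarrow> real" where
  "interarrival K Y \<omega> = (\<Sum>j=1..K \<omega>. Y j \<omega>)"

definition waiting_time :: "('a \<Rightarrow> real) \<Rightarrow> ('a \<Rightarrow> nat) \<Rightarrow> (nat \<Rightarrow> 'a \<Rightarrow> real) \<Rightarrow> 'a \<Rightarrow> real" where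
  "waiting_time U K Y \<omega> = max 0 (U \<omega> - interarrival K Y \<omega>)"

definition system_time ::
    "real \<Rightarrow> ('a \<Rightarrow> real) \<Rightarrow> ('a \<Rightarrow> nat) \<Rightarrow> (nat \<Rightarrow> 'a \<Rightarrow> real) \<Rightarrow> 'a \<Rightarrow> real" where
  "system_time D U K Y \<omega> = waiting_time U K Y \<omega> + D"

definition hop_squares :: "real \<Rightarrow> ('a \<Rightarrow> nat) \<Rightarrow> (nat \<Rightarrow> 'a \<Rightarrow> real) \<Rightarrow> 'a \<Rightarrow> real" where
  "hop_squares v K Y \<omega> = (\<Sum>j=1..K \<omega>. v\<^sup>2 * (Y j \<omega>)\<^sup>2)"

definition cycle_cost ::
    "real \<Rightarrow> real \<Rightarrow> ('a \<Rightarrow> real) \<Rightarrow> ('a \<Rightarrow> nat) \<Rightarrow> (nat \<Rightarrow> 'a \<Rightarrow> real) \<Rightarrow> 'a \<Rightarrow> real" where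
  "cycle_cost v D U K Y \<omega> =
     (\<Sum>j=1..K \<omega>. v\<^sup>2 / 3 * (Y j \<omega>) ^ 3)
   + (\<Sum>j=1..K \<omega>. Y j \<omega> * (\<Sum>l=1..<j. v\<^sup>2 * (Y l \<omega>)\<^sup>2))
   + hop_squares v K Y \<omega> * system_time D U K Y \<omega>"

definition age_of_positioning ::
    "'a measure \<Rightarrow> real \<Rightarrow> real \<Rightarrow> real \<Rightarrow> real \<Rightarrow> real \<Rightarrow>
     ('a \<Rightarrow> real) \<Rightarrow> ('a \<Rightarrow> nat) \<Rightarrow> (nat \<Rightarrow> 'a \<Rightarrow> real) \<Rightarrow> real" where
  "age_of_positioning M p \<kappa> lam v D U K Y = p * \<kappa> * lam * (LINT \<omega>|M. cycle_cost v D U K Y \<omega>)"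

text \<open>In the following, \<open>a\<close> is the arrival rate at the queue and \<open>D\<close> the service time, so that \<open>a * D\<close>
  is the load \<open>\<rho>\<close>.\<close>

definition md1_wait_cdf :: "real \<Rightarrow> real \<Rightarrow> real \<Rightarrow> real" where
  "md1_wait_cdf a D w =
     (if w < 0 then 0
      else (1 - a * D) *
        (\<Sum>n = 0..nat \<lfloor>w / D\<rfloor>. exp (a * (w - real n * D)) * (- a * (w - real n * D)) ^ n / fact n))"

definition md1_wait_pdf :: "real \<Rightarrow> real \<Rightarrow> real \<Rightarrow> real" where
  "md1_wait_pdf a D w = deriv (md1_wait_cdf a D) w"

text \<open>
  The waiting time has an atom at 0 (an arriving update finds the server idle with positive
  probability): the cumulative distribution function jumps from 0 to \<open>md1_wait_cdf a D 0\<close> at 0.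
  Hence its derivative, the probability density, contains a Dirac mass of that weight at 0, besides
  the function \<open>md1_wait_pdf a D\<close>. \<open>md1_wait_pdf_integral a D \<phi> b\<close> is the integral of \<open>\<phi>\<close> against
  that density over the closed interval from 0 to \<open>b\<close> (for \<open>b \<ge> 0\<close>). Without the Dirac mass
  the density would not integrate to 1.
\<close>

definition md1_wait_pdf_integral :: "real \<Rightarrow> real \<Rightarrow> (real \<Rightarrow> real) \<Rightarrow> real \<Rightarrow> real" where
  "md1_wait_pdf_integral a D \<phi> b =
     \<phi> 0 * md1_wait_cdf a D 0 + (LBINT w:{0..b}. \<phi> w * md1_wait_pdf a D w)"

definition wait_kernel :: "real \<Rightarrow> real \<Rightarrow> nat \<Rightarrow> (nat \<Rightarrow> real) \<Rightarrow> real" where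
  "wait_kernel a D k y =
     D * (a * D) / (2 * (1 - a * D)) + D - (\<Sum>j=1..k. y j)
   - of_bool ((\<Sum>j=1..k. y j) \<ge> D) *
       md1_wait_pdf_integral a D (\<lambda>w. w + D - (\<Sum>j=1..k. y j)) ((\<Sum>j=1..k. y j) - D)"

definition hop_integrand ::
    "real \<Rightarrow> real \<Rightarrow> real \<Rightarrow> real \<Rightarrow> nat \<Rightarrow> (nat \<Rightarrow> real) \<Rightarrow> real" where
  "hop_integrand v lam a D k y =
     lam ^ k * wait_kernel a D k y * (v\<^sup>2 * (\<Sum>j=1..k. (y j)\<^sup>2)) * exp (- lam * (\<Sum>j=1..k. y j))"

definition hop_integral :: "real \<Rightarrow> real \<Rightarrow> real \<Rightarrow> real \<Rightarrow> nat \<Rightarrow> real" where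
  "hop_integral v lam a D k =
     (LINT y:(\<Pi>\<^sub>E j\<in>{1..k}. {0..})|(\<Pi>\<^sub>M j\<in>{1..k}. lborel). hop_integrand v lam a D k y)"

end

theory Submission
  imports Defs "HOL-Real_Asymp.Real_Asymp"
begin

text \<open>
  A geometric number of hops of rate \<open>lam\<close> makes the interarrival time \<open>X\<close> exponential of rate
  \<open>a = p * lam\<close>, so that stationarity of Lindley's recursion says \<open>F w = E (F (w + X - D))\<close> for
  \<open>w \<ge> 0\<close>, where \<open>F\<close> is the distribution function of the waiting time \<open>W\<close>. In terms of
  \<open>exp (- a * w) * F w\<close> this is a Volterra equation with delay \<open>D\<close>, which determines \<open>F\<close> from \<open>F 0\<close>
  on successive intervals of length \<open>D\<close>. Integrating the equivalent equation
  \<open>F' w = a * F w - a * F (w - D)\<close> shows that \<open>F w - F 0\<close> is \<open>a\<close> times the integral of \<open>F\<close> over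
  \<open>{w - D..w}\<close>; letting \<open>w\<close> tend to infinity gives \<open>F 0 = 1 - a * D\<close>. Consequently \<open>1 - F w\<close> is
  \<open>a\<close> times the integral of \<open>1 - F\<close> over \<open>{w - D..w}\<close>, and integrating this once more gives the mean
  waiting time. An integration by parts identifies the kernel of the theorem, at hops of total length
  \<open>x\<close>, with the integral of \<open>1 - F\<close> over \<open>{x - D..}\<close>, that is with \<open>E (max 0 (W + D - x))\<close>.
  By independence the expected cost of a cycle with \<open>k\<close> hops is then computed term by term, and the
  geometric mixture over \<open>k\<close> is taken with nonnegative integrals, so that summability and
  integrability come out together.
\<close>

section \<open>Auxiliary facts on integrals, product densities and power series\<close>

lemma set_integrable_bounded:
  fixes f :: "real \<Rightarrow> real"
  assumes [measurable]: "f \<in> borel_measurable borel" and B: "\<And>x. x \<in> {l..u} \<Longrightarrow> \<bar>f x\<bar> \<le> B"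
  shows "set_integrable lborel {l..u} f"
  unfolding set_integrable_def
proof (rule Bochner_Integration.integrable_bound)
  show "integrable lborel (\<lambda>x. B * indicator {l..u} x)"
    by (intro integrable_mult_right integrable_real_indicator) (auto simp: emeasure_lborel_Icc_eq)
  show "AE x in lborel. norm (indicator {l..u} x *\<^sub>R f x) \<le> norm (B * indicator {l..u} x)"
    using B by (intro AE_I2) (force split: split_indicator)
qed simp

text \<open>A product measure is determined by its values on boxes, and on a box both the indicator
  and the density factor over the coordinates. This turns the joint law of the hops into an integral
  against the Lebesgue product that occurs in \<open>hop_integral\<close>.\<close>

lemma PiM_density:
  assumes I: "finite I" and f: "\<And>i. f i \<in> borel_measurable (N i)"
    and N: "product_sigma_finite N" and dN: "product_sigma_finite (\<lambda>i. density (N i) (f i))"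
  shows "(\<Pi>\<^sub>M i\<in>I. density (N i) (f i)) = density (\<Pi>\<^sub>M i\<in>I. N i) (\<lambda>x. \<Prod>i\<in>I. f i (x i))"
proof (rule product_sigma_finite.PiM_eqI[OF dN I, symmetric])
  note [measurable] = f
  have meas: "(\<lambda>x. \<Prod>i\<in>I. f i (x i)) \<in> borel_measurable (Pi\<^sub>M I N)"
    by measurable
  show "sets (density (Pi\<^sub>M I N) (\<lambda>x. \<Prod>i\<in>I. f i (x i))) = sets (\<Pi>\<^sub>M i\<in>I. density (N i) (f i))"
    by (simp cong: sets_PiM_cong)
  fix A assume "\<And>i. i \<in> I \<Longrightarrow> A i \<in> sets (density (N i) (f i))"
  then have A: "A i \<in> sets (N i)" if "i \<in> I" for i
    using that by simp
  have "emeasure (density (Pi\<^sub>M I N) (\<lambda>x. \<Prod>i\<in>I. f i (x i))) (Pi\<^sub>E I A)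
    = (\<integral>\<^sup>+x. (\<Prod>i\<in>I. f i (x i)) * indicator (Pi\<^sub>E I A) x \<partial>Pi\<^sub>M I N)"
    by (intro emeasure_density meas sets_PiM_I_finite I A)
  also have "\<dots> = (\<integral>\<^sup>+x. (\<Prod>i\<in>I. f i (x i) * indicator (A i) (x i)) \<partial>Pi\<^sub>M I N)"
  proof (rule nn_integral_cong)
    fix x assume "x \<in> space (Pi\<^sub>M I N)"
    then have "indicator (Pi\<^sub>E I A) x = (\<Prod>i\<in>I. indicator (A i) (x i) :: ennreal)"
      using I by (auto simp: space_PiM PiE_iff indicator_def prod_zero_iff)
    then show "(\<Prod>i\<in>I. f i (x i)) * indicator (Pi\<^sub>E I A) x = (\<Prod>i\<in>I. f i (x i) * indicator (A i) (x i))"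
      by (simp add: prod.distrib)
  qed
  also have "\<dots> = (\<Prod>i\<in>I. \<integral>\<^sup>+x. f i x * indicator (A i) x \<partial>N i)"
    by (rule product_sigma_finite.product_nn_integral_prod[OF N I]) (use A in measurable)
  also have "\<dots> = (\<Prod>i\<in>I. emeasure (density (N i) (f i)) (A i))"
    by (intro prod.cong refl) (simp add: emeasure_density A)
  finally show "emeasure (density (Pi\<^sub>M I N) (\<lambda>x. \<Prod>i\<in>I. f i (x i))) (Pi\<^sub>E I A)
    = (\<Prod>i\<in>I. emeasure (density (N i) (f i)) (A i))" .
qed

lemma wait_kernel_cong:
  "(\<Sum>j=1..k. y j) = (\<Sum>j=1..k. z j) \<Longrightarrow> wait_kernel a D k y = wait_kernel a D k z"
  by (simp only: wait_kernel_def)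

text \<open>The Cauchy product of the series of \<open>1 / (1 - q)^2\<close> and
  \<open>1 / (1 - q)\<close> has the triangular numbers as coefficients. Up to the factor
  \<open>2 * q\<close> and an index shift this is the claimed series, which later yields the mean of
  \<open>K * (K - 1)\<close>.\<close>

lemma sums_Suc_power:
  fixes q :: real
  assumes "norm q < 1"
  shows "(\<lambda>n. real (Suc n) * real n * q ^ n) sums (2 * q / (1 - q) ^ 3)"
proof -
  have "summable (\<lambda>k. norm (q ^ k))"
    unfolding norm_power using assms by (intro summable_geometric) simp
  moreover have "summable (\<lambda>k. norm (real (Suc k) * q ^ k))"
    unfolding norm_mult norm_power using geometric_deriv_sums[of "norm q"] assms by (simp add: sums_iff)
  ultimately have "(\<lambda>k. \<Sum>i\<le>k. real (Suc i) * q ^ i * q ^ (k - i)) sums ((\<Sum>k. real (Suc k) * q ^ k) * (\<Sum>k. q ^ k))"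
    by (intro Cauchy_product_sums)
  moreover have "(\<Sum>i\<le>k. real (Suc i) * q ^ i * q ^ (k - i)) = real (Suc k) * real (Suc (Suc k)) / 2 * q ^ k" for k
  proof -
    have "(\<Sum>i\<le>k. real (Suc i) * q ^ i * q ^ (k - i)) = (\<Sum>i\<le>k. real (Suc i)) * q ^ k"
      unfolding sum_distrib_right
      by (intro sum.cong refl) (simp add: mult.assoc flip: power_add)
    also have "(\<Sum>i\<le>k. real (Suc i)) = real (Suc k) * real (Suc (Suc k)) / 2"
      by (induction k) (auto simp: field_simps)
    finally show ?thesis .
  qed
  moreover have "(\<Sum>k. real (Suc k) * q ^ k) * (\<Sum>k. q ^ k) = 1 / (1 - q) ^ 3"
    using assms geometric_deriv_sums[of q] geometric_sums[of q]
    by (simp add: sums_iff power2_eq_square power3_eq_cube)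
  ultimately have "(\<lambda>k. real (Suc k) * real (Suc (Suc k)) / 2 * q ^ k) sums (1 / (1 - q) ^ 3)"
    by (simp only:)
  then have "(\<lambda>k. 2 * q * (real (Suc k) * real (Suc (Suc k)) / 2 * q ^ k)) sums (2 * q * (1 / (1 - q) ^ 3))"
    by (rule sums_mult)
  moreover have "2 * q * (real (Suc k) * real (Suc (Suc k)) / 2 * q ^ k) = real (Suc (Suc k)) * real (Suc k) * q ^ Suc k" for k
    by simp
  ultimately have "(\<lambda>k. real (Suc (Suc k)) * real (Suc k) * q ^ Suc k) sums (2 * q / (1 - q) ^ 3)"
    by (simp only: times_divide_eq_right mult_1_right)
  \<comment> \<open>The shift adds nothing to the sum, because the term of index 0 is 0.\<close>
  then show ?thesis
    by (subst (asm) sums_Suc_iff) simp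
qed

subsection \<open>The stationary waiting time\<close>

text \<open>Only the distribution function is kept here, without a probability space. For
  \<open>w \<ge> 0\<close> the event \<open>max 0 (W + D - X) \<le> w\<close> is
  \<open>W \<le> w + X - D\<close>, whence the form of \<open>lindley\<close>; as a nonnegative
  integral it presupposes no integrability.\<close>

locale md1_lindley =
  fixes a D :: real and F :: "real \<Rightarrow> real"
  assumes a_pos: "0 < a" and D_pos: "0 < D" and load: "a * D < 1"
    and mono_F: "mono F" and F_neg: "x < 0 \<Longrightarrow> F x = 0"
    and F_lim: "(F \<longlongrightarrow> 1) at_top"
    and lindley: "0 \<le> w \<Longrightarrow>
      ennreal (F w) = (\<integral>\<^sup>+x. ennreal (exponential_density a x * F (w + x - D)) \<partial>lborel)"
begin

section \<open>From Lindley's equation to a Volterra equation\<close>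

definition damped :: "real \<Rightarrow> real" where "damped s = exp (- a * s) * F s"

lemma F_nonneg: "0 \<le> F x"
  using monoD[OF mono_F, of "min x (-1)" x] F_neg[of "min x (-1)"] by simp

lemma F_le_1: "F x \<le> 1"
  by (rule tendsto_lowerbound[OF F_lim _ trivial_limit_at_top_linorder])
    (auto simp: eventually_at_top_linorder intro!: exI[of _ x] monoD[OF mono_F])

lemma F_measurable [measurable]: "F \<in> borel_measurable borel"
  by (rule borel_measurable_mono[OF mono_F])

lemma damped_measurable [measurable]: "damped \<in> borel_measurable borel"
  unfolding damped_def by measurable

lemma damped_nonneg: "0 \<le> damped s"
  by (simp add: damped_def F_nonneg)

lemma damped_neg: "s < 0 \<Longrightarrow> damped s = 0"
  by (simp add: damped_def F_neg)

lemma F_eq_damped: "F s = exp (a * s) * damped s"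
  by (simp add: damped_def flip: mult.assoc exp_add)

text \<open>After the substitution \<open>s = w + x - D\<close> the exponential density splits into
  a factor in \<open>w\<close> and the factor \<open>exp (- a * s)\<close> that
  \<open>damped\<close> absorbs. What remains of \<open>w\<close> under the integral is its lower
  limit \<open>w - D\<close>, from the support of the density.\<close>

lemma tail_nn:
  assumes "0 \<le> w"
  shows "ennreal (damped w) = ennreal (a * exp (- a * D)) * (\<integral>\<^sup>+s. ennreal (damped s * indicator {w - D..} s) \<partial>lborel)"
proof -
  have "ennreal (F w) = (\<integral>\<^sup>+x. ennreal (exponential_density a x * F (w + x - D)) \<partial>lborel)"
    by (rule lindley[OF assms])
  also have "\<dots> = (\<integral>\<^sup>+s. ennreal (exponential_density a (s - w + D) * F s) \<partial>lborel)"
    by (subst nn_integral_real_affine[where c=1 and t="D - w"]) (auto simp: algebra_simps)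
  also have "\<dots> = (\<integral>\<^sup>+s. ennreal (a * exp (a * (w - D))) * ennreal (damped s * indicator {w - D..} s) \<partial>lborel)"
    using a_pos by (intro nn_integral_cong)
      (auto simp: exponential_density_def damped_def exp_add[symmetric] F_nonneg algebra_simps
        ennreal_mult'[symmetric] split: split_indicator)
  also have "\<dots> = ennreal (a * exp (a * (w - D))) * (\<integral>\<^sup>+s. ennreal (damped s * indicator {w - D..} s) \<partial>lborel)"
    by (intro nn_integral_cmult) auto
  finally have "ennreal (exp (- a * w)) * ennreal (F w) = ennreal (exp (- a * w)) * ennreal (a * exp (a * (w - D))) * (\<integral>\<^sup>+s. ennreal (damped s * indicator {w - D..} s) \<partial>lborel)"
    by (simp add: mult.assoc)
  moreover have "ennreal (exp (- a * w)) * ennreal (a * exp (a * (w - D))) = ennreal (a * exp (- a * D))"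
    using a_pos by (simp add: ennreal_mult'[symmetric] exp_add[symmetric] algebra_simps)
  ultimately show ?thesis
    by (simp add: damped_def ennreal_mult')
qed

text \<open>At \<open>w = D\<close> the lower limit is 0, so the tail equation equates the whole
  mass of \<open>damped\<close>, times a positive constant, with a finite number.\<close>

lemma integrable_damped: "integrable lborel damped"
proof (rule integrableI_nonneg)
  have "ennreal (a * exp (- a * D)) * (\<integral>\<^sup>+s. ennreal (damped s * indicator {D - D..} s) \<partial>lborel) < \<infinity>"
    using D_pos by (subst tail_nn[symmetric]) auto
  moreover have "(\<integral>\<^sup>+s. ennreal (damped s * indicator {D - D..} s) \<partial>lborel) = (\<integral>\<^sup>+s. ennreal (damped s) \<partial>lborel)"
    by (intro nn_integral_cong) (auto simp: damped_neg split: split_indicator)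
  ultimately show "(\<integral>\<^sup>+s. ennreal (damped s) \<partial>lborel) < \<infinity>"
    using a_pos by (auto simp: ennreal_mult_less_top)
qed (auto simp: damped_nonneg)

lemma set_integrable_damped: "A \<in> sets borel \<Longrightarrow> set_integrable lborel A damped"
  using integrable_damped unfolding set_integrable_def
  by (intro integrable_mult_indicator) auto

lemma tail:
  assumes "0 \<le> w"
  shows "damped w = a * exp (- a * D) * (LBINT s:{w - D..}. damped s)"
proof -
  have "(\<integral>\<^sup>+s. ennreal (damped s * indicator {w - D..} s) \<partial>lborel) = ennreal (LBINT s:{w - D..}. damped s)"
    unfolding set_lebesgue_integral_def
    using set_integrable_damped[of "{w - D..}"]
    by (subst nn_integral_eq_integral[symmetric])
      (auto simp: set_integrable_def damped_nonneg mult.commute)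
  then have "ennreal (damped w) = ennreal (a * exp (- a * D) * (LBINT s:{w - D..}. damped s))"
    using tail_nn[OF assms] a_pos by (simp add: ennreal_mult')
  moreover have "0 \<le> (LBINT s:{w - D..}. damped s)"
    unfolding set_lebesgue_integral_def by (simp add: damped_nonneg)
  ultimately show ?thesis
    using a_pos damped_nonneg by (simp add: ennreal_inj)
qed

lemma damped_integrable_on [simp]: "damped integrable_on {x..y}"
  by (rule set_borel_integral_eq_integral[OF set_integrable_damped]) simp

text \<open>Since \<open>F\<close> vanishes on the negatives, starting the integral at \<open>- D\<close> covers the case \<open>w < D\<close> too.\<close>

lemma damped_volterra:
  assumes "0 \<le> w"
  shows "damped w = damped 0 - a * exp (- a * D) * integral {- D..w - D} damped"
proof -
  have "(LBINT s:{- D..}. damped s) = (LBINT s:{- D..<w - D}. damped s) + (LBINT s:{w - D..}. damped s)"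
    using assms by (subst set_integral_Un[symmetric])
      (auto intro!: set_integrable_damped simp: ivl_disj_un)
  also have "(LBINT s:{- D..<w - D}. damped s) = (LBINT s:{- D..w - D}. damped s)"
    using AE_lborel_singleton[of "w - D"]
    by (intro set_integral_cong_set) (auto simp: set_borel_measurable_def)
  also have "\<dots> = integral {- D..w - D} damped"
    by (rule set_borel_integral_eq_integral[OF set_integrable_damped]) simp
  finally show ?thesis
    using tail[OF assms] tail[of 0] by (simp add: algebra_simps)
qed

text \<open>The right-hand side of the Volterra equation is an indefinite integral, so integrability
  alone already gives continuity. At 0 it is one-sided, since \<open>F\<close> jumps there.\<close>

lemma continuous_on_damped: "continuous_on {0..} damped"
proof -
  have "continuous_on {0..b} damped" for b
  proof -
    have "continuous_on {- D..b - D} (\<lambda>w. integral {- D..w} damped)"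
      by (rule indefinite_integral_continuous_1) simp
    then have "continuous_on {0..b} (\<lambda>w. damped 0 - a * exp (- a * D) * integral {- D..w - D} damped)"
      by (intro continuous_intros continuous_on_compose2[where f="\<lambda>w. w - D" and t="{- D..b - D}"]) auto
    then show ?thesis
      by (rule continuous_on_eq) (rule damped_volterra[symmetric], simp)
  qed
  \<comment> \<open>Continuity at \<open>x\<close> is local, so the compact interval
    \<open>{0..x + 1}\<close> suffices.\<close>
  then have "continuous (at x within {0..}) damped" if "0 \<le> x" for x
    using that
    by (subst at_within_nhd[of x "{..<x + 1}" "{0..}" "{0..x + 1}"])
      (auto simp: continuous_on_eq_continuous_within)
  then show ?thesis
    by (auto simp: continuous_on_eq_continuous_within)
qed

lemma isCont_damped:
  assumes "s \<noteq> 0"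
  shows "isCont damped s"
proof (cases "0 < s")
  case True
  then show ?thesis
    using continuous_on_damped by (intro continuous_on_interior) auto
next
  case False
  have "continuous_on {..<0} damped"
    using continuous_on_const[of "{..<0}" "0::real"] by (rule continuous_on_eq) (simp add: damped_neg)
  then show ?thesis
    using False assms by (auto simp: continuous_on_eq_continuous_at)
qed

lemma continuous_on_F: "continuous_on {0..} F"
proof -
  have "continuous_on {0..} (\<lambda>s. exp (a * s) * damped s)"
    by (intro continuous_intros continuous_on_damped)
  then show ?thesis
    by (simp flip: F_eq_damped)
qed

text \<open>The fundamental theorem of calculus is applied at \<open>w - D\<close>, where the
  integrand must be continuous; \<open>w = D\<close> would hit its jump at 0.\<close>

lemma has_field_derivative_damped:
  assumes "0 < w" "w \<noteq> D"
  shows "(damped has_field_derivative (- a * exp (- a * D) * damped (w - D))) (at w)"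
proof -
  have "((\<lambda>u. integral {- D..u} damped) has_field_derivative damped (w - D)) (at (w - D) within {- D..w})"
    using assms D_pos
    unfolding has_real_derivative_iff_has_vector_derivative
    by (intro integral_has_vector_derivative_continuous_at[where S="{}", simplified])
      (auto intro!: continuous_at_imp_continuous_at_within[OF isCont_damped])
  then have *: "((\<lambda>u. integral {- D..u} damped) has_field_derivative damped (w - D)) (at (w - D))"
    using assms D_pos by (simp add: at_within_Icc_at)
  have "((\<lambda>w. damped 0 - a * exp (- a * D) * integral {- D..w - D} damped) has_field_derivative
      (- a * exp (- a * D) * damped (w - D))) (at w)"
    using * by (auto intro!: derivative_eq_intros DERIV_chain2[where g="\<lambda>w. w - D"])
  then show ?thesis
    by (rule has_field_derivative_transform_within_open[where S="{0<..}"])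
      (use assms in simp, simp, use assms in simp, rule damped_volterra[symmetric], simp)
qed

lemma has_field_derivative_F:
  assumes "0 < w" "w \<noteq> D"
  shows "(F has_field_derivative (a * F w - a * F (w - D))) (at w)"
proof -
  have "((\<lambda>s. exp (a * s) * damped s) has_field_derivative
      a * (exp (a * w) * damped w) - a * (exp (a * (w - D)) * damped (w - D))) (at w)"
    by (rule derivative_eq_intros has_field_derivative_damped[OF assms] refl)+
      (simp add: algebra_simps exp_diff exp_minus divide_inverse)
  then show ?thesis
    by (simp flip: F_eq_damped)
qed

section \<open>The integrated equation and the value of \<open>F\<close> at 0\<close>

lemma F_integrable_on [simp]: "F integrable_on {x..y}"
  by (rule integrable_on_mono_on) (use mono_F in \<open>auto simp: mono_on_def mono_def\<close>)

text \<open>Since \<open>F\<close> is continuous on \<open>{0..w}\<close>, the fundamental theorem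
  of calculus tolerates the kink at \<open>D\<close>.\<close>

lemma F_has_integral:
  assumes "0 \<le> w"
  shows "((\<lambda>s. a * F s - a * F (s - D)) has_integral (F w - F 0)) {0..w}"
  by (rule fundamental_theorem_of_calculus_interior_strong[of "{D}"])
    (use assms has_field_derivative_F continuous_on_F in
      \<open>auto simp: has_real_derivative_iff_has_vector_derivative intro: continuous_on_subset\<close>)

text \<open>The two terms of the integrand contribute the windows \<open>{0..w}\<close> and
  \<open>{- D..w - D}\<close>. As \<open>F\<close> vanishes on the negatives, the first may be
  extended to \<open>{- D..w}\<close>, and the difference leaves \<open>{w - D..w}\<close>.\<close>

lemma F_difference:
  assumes "0 \<le> w"
  shows "F w - F 0 = a * integral {w - D..w} F"
proof -
  have "((\<lambda>s. F (s - D)) has_integral integral {- D..w - D} F) {0..w}"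
    using has_integral_affinity'[OF integrable_integral[of F "cbox (- D) (w - D)"], of 1 "- D"]
    by simp
  then have "((\<lambda>s. a * F s - a * F (s - D)) has_integral
      a * integral {0..w} F - a * integral {- D..w - D} F) {0..w}"
    by (intro has_integral_diff has_integral_mult_right integrable_integral) simp_all
  with F_has_integral[OF assms] have "F w - F 0 = a * integral {0..w} F - a * integral {- D..w - D} F"
    by (rule has_integral_unique)
  moreover have "integral {- D..0} F = 0"
    using D_pos by (subst integral_spike[where g="\<lambda>_. 0" and S="{0}"]) (auto simp: F_neg)
  then have "integral {0..w} F = integral {- D..w} F"
    using Henstock_Kurzweil_Integration.integral_combine[of "- D" 0 w F] assms D_pos by simp
  moreover have "integral {- D..w} F = integral {- D..w - D} F + integral {w - D..w} F"
    using Henstock_Kurzweil_Integration.integral_combine[of "- D" "w - D" w F] assms D_pos by simp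
  ultimately show ?thesis
    by (simp add: algebra_simps)
qed

lemma integral_complement:
  assumes "0 \<le> w"
  shows "integral {w - D..w} (\<lambda>s. 1 - F s) = D - integral {w - D..w} F"
  using D_pos by (subst Henstock_Kurzweil_Integration.integral_diff) auto

text \<open>By monotonicity the window integral lies between \<open>D * F (w - D)\<close> and
  \<open>D\<close>. Both bounds tend to \<open>D\<close>, which determines the limit
  \<open>1 - F 0\<close> of \<open>F w - F 0\<close>.\<close>

lemma F_0: "F 0 = 1 - a * D"
proof -
  have lower: "a * (D * F (w - D)) \<le> F w - F 0" and upper: "F w - F 0 \<le> a * D" if "0 \<le> w" for w
  proof -
    have "integral {w - D..w} (\<lambda>_. F (w - D)) \<le> integral {w - D..w} F"
      by (rule integral_le) (auto intro: monoD[OF mono_F])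
    then show "a * (D * F (w - D)) \<le> F w - F 0"
      using F_difference[OF that] a_pos D_pos by simp
    have "integral {w - D..w} F \<le> integral {w - D..w} (\<lambda>_. 1)"
      by (rule integral_le) (auto simp: F_le_1)
    then show "F w - F 0 \<le> a * D"
      using F_difference[OF that] a_pos D_pos by simp
  qed
  have "((\<lambda>w. F (w - D)) \<longlongrightarrow> 1) at_top"
    by (rule filterlim_compose[OF F_lim]) (real_asymp)
  then have "((\<lambda>w. a * (D * F (w - D))) \<longlongrightarrow> a * (D * 1)) at_top"
    by (intro tendsto_intros)
  then have lim: "((\<lambda>w. a * (D * F (w - D))) \<longlongrightarrow> a * D) at_top"
    by simp
  have "((\<lambda>w. F w - F 0) \<longlongrightarrow> a * D) at_top"
  proof (rule real_tendsto_sandwich[OF _ _ lim tendsto_const])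
    show "eventually (\<lambda>w. a * (D * F (w - D)) \<le> F w - F 0) at_top"
      using eventually_ge_at_top[of 0] by eventually_elim (rule lower)
    show "eventually (\<lambda>w. F w - F 0 \<le> a * D) at_top"
      using eventually_ge_at_top[of 0] by eventually_elim (rule upper)
  qed
  moreover have "((\<lambda>w. F w - F 0) \<longlongrightarrow> 1 - F 0) at_top"
    by (intro tendsto_intros F_lim)
  ultimately have "a * D = 1 - F 0"
    by (rule tendsto_unique[OF trivial_limit_at_top_linorder])
  then show ?thesis
    by simp
qed

text \<open>Since \<open>1 - F 0 = a * D\<close> is \<open>a\<close> times the length of the window,
  the inhomogeneous term disappears on passing to \<open>1 - F\<close>.\<close>

lemma complement_eq:
  assumes "0 \<le> w"
  shows "1 - F w = a * integral {w - D..w} (\<lambda>s. 1 - F s)"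
  unfolding integral_complement[OF assms] right_diff_distrib
  using F_difference[OF assms] F_0 by linarith

section \<open>Solution of the Volterra equation as a finite series\<close>

definition hinge_power :: "nat \<Rightarrow> real \<Rightarrow> real" where
  "hinge_power n s = (if n = 0 then 1 else max 0 (s - real n * D) ^ n)"

lemma has_integral_hinge_power:
  assumes "0 \<le> x"
  shows "(hinge_power n has_integral max 0 (x - real n * D) ^ Suc n / real (Suc n)) {0..x}"
proof -
  have "((\<lambda>s. max 0 (s - real n * D) ^ Suc n / real (Suc n)) has_vector_derivative hinge_power n s) (at s)"
    if "0 < s" "s \<noteq> real n * D" for s
  proof (cases "real n * D < s")
    case True
    have "((\<lambda>s. (s - real n * D) ^ Suc n / real (Suc n)) has_real_derivative hinge_power n s) (at s)"
      using True by (auto intro!: derivative_eq_intros simp: hinge_power_def simp del: power_Suc of_nat_Suc)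
    then show ?thesis
      unfolding has_real_derivative_iff_has_vector_derivative[symmetric]
      by (rule has_field_derivative_transform_within_open[where S="{real n * D<..}"]) (use True in auto)
  next
    case False
    \<comment> \<open>Here \<open>0 < s < n * D\<close> forces \<open>n > 0\<close>, so that the
      power of 0 is 0.\<close>
    have "((\<lambda>s. 0) has_real_derivative hinge_power n s) (at s)"
      using False that by (auto simp: hinge_power_def zero_power)
    then show ?thesis
      unfolding has_real_derivative_iff_has_vector_derivative[symmetric]
      by (rule has_field_derivative_transform_within_open[where S="{..<real n * D}"])
        (use False that in auto)
  qed
  then have "(hinge_power n has_integral (max 0 (x - real n * D) ^ Suc n / real (Suc n)
      - max 0 (0 - real n * D) ^ Suc n / real (Suc n))) {0..x}"
    using assms
    by (intro fundamental_theorem_of_calculus_interior_strong[of "{real n * D}"])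
      (auto intro!: continuous_intros simp del: power_Suc of_nat_Suc)
  moreover have "max 0 (0 - real n * D) = 0"
    using D_pos by simp
  ultimately show ?thesis
    by simp
qed

text \<open>Method of steps: the values up to \<open>(N + 2) * D\<close> need \<open>damped\<close>
  only up to \<open>(N + 1) * D\<close>, and integrating a hinge power raises its degree by one and
  moves its hinge by \<open>D\<close>. As the hinge powers of positive degree vanish to the left of
  their hinges, one number of terms serves the whole interval, in place of a sum whose length varies
  with \<open>w\<close>.\<close>

lemma damped_series:
  assumes "0 \<le> w" "w \<le> real (Suc N) * D"
  shows "damped w = F 0 * (\<Sum>n\<le>N. exp (- a * real n * D) * (- a) ^ n / fact n * hinge_power n w)"
  using assms
proof (induction N arbitrary: w)
  case 0
  have "integral {- D..w - D} damped = 0"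
    using 0 D_pos by (subst integral_spike[where g="\<lambda>_. 0" and S="{0}"]) (auto simp: damped_neg)
  then show ?case
    using damped_volterra[OF 0(1)] by (simp add: hinge_power_def damped_def)
next
  case (Suc N)
  let ?c = "\<lambda>n. exp (- a * real n * D) * (- a) ^ n / fact n"
  have "integral {- D..w - D} damped = F 0 * (\<Sum>n\<le>N. ?c n * (max 0 (w - real (Suc n) * D) ^ Suc n / real (Suc n)))"
  proof (cases "D \<le> w")
    case True
    have "integral {- D..0} damped = 0"
      using D_pos by (subst integral_spike[where g="\<lambda>_. 0" and S="{0}"]) (auto simp: damped_neg)
    then have "integral {- D..w - D} damped = integral {0..w - D} damped"
      using Henstock_Kurzweil_Integration.integral_combine[of "- D" 0 "w - D" damped] True D_pos by simp
    also have "\<dots> = integral {0..w - D} (\<lambda>s. F 0 * (\<Sum>n\<le>N. ?c n * hinge_power n s))"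
      by (intro integral_cong Suc.IH) (use Suc.prems in \<open>auto simp: algebra_simps\<close>)
    also have "\<dots> = F 0 * (\<Sum>n\<le>N. ?c n * (max 0 (w - D - real n * D) ^ Suc n / real (Suc n)))"
      by (intro integral_unique has_integral_mult_right has_integral_sum has_integral_hinge_power)
        (use True in auto)
    finally show ?thesis
      by (simp add: algebra_simps)
  next
    case False
    have "w - real (Suc n) * D \<le> 0" for n
    proof -
      have "1 * D \<le> real (Suc n) * D"
        by (rule mult_right_mono) (use D_pos in auto)
      then show ?thesis
        using False by linarith
    qed
    moreover have "integral {- D..w - D} damped = 0"
      using False by (subst integral_cong[where g="\<lambda>_. 0"]) (auto simp: damped_neg)
    ultimately show ?thesis
      by (simp add: max_absorb1)
  qed
  \<comment> \<open>Recursion of the coefficients: each arises from its predecessor by the factor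
    \<open>- a * exp (- a * D)\<close> of the equation and the division by \<open>n + 1\<close> from
    the integration.\<close>
  moreover have step: "a * exp (- a * D) * (?c n * (x / real (Suc n))) = - (?c (Suc n) * x)" for n x
  proof -
    have "exp (- a * real (Suc n) * D) = exp (- a * D) * exp (- a * real n * D)"
      by (simp add: exp_add[symmetric] algebra_simps)
    then show ?thesis
      by (simp only: power_Suc fact_Suc of_nat_mult) (simp add: field_simps del: of_nat_Suc)
  qed
  ultimately have "damped w = damped 0 - a * exp (- a * D) * (F 0 * (\<Sum>n\<le>N. ?c n * (max 0 (w - real (Suc n) * D) ^ Suc n / real (Suc n))))"
    using damped_volterra[OF Suc.prems(1)] by metis
  also have "\<dots> = F 0 * (1 + (\<Sum>n\<le>N. ?c (Suc n) * max 0 (w - real (Suc n) * D) ^ Suc n))"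
    unfolding mult.left_commute[of "a * exp (- a * D)" "F 0"] sum_distrib_left[of "a * exp (- a * D)"] step sum_negf
    by (simp only: damped_def algebra_simps) simp
  also have "(\<Sum>n\<le>N. ?c (Suc n) * max 0 (w - real (Suc n) * D) ^ Suc n) = (\<Sum>n\<le>N. ?c (Suc n) * hinge_power (Suc n) w)"
    by (simp only: hinge_power_def nat.distinct if_False)
  also have "1 + (\<Sum>n\<le>N. ?c (Suc n) * hinge_power (Suc n) w) = (\<Sum>n\<le>Suc N. ?c n * hinge_power n w)"
    by (subst sum.atMost_Suc_shift) (simp add: hinge_power_def)
  finally show ?case .
qed

text \<open>With \<open>N\<close> the floor of \<open>w / D\<close>, all hinges up to
  \<open>N\<close> are active, so the maxima drop out, and \<open>exp (a * w)\<close> merges with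
  \<open>exp (- a * n * D)\<close>.\<close>

lemma F_eq_cdf: "F = md1_wait_cdf a D"
proof
  fix w
  show "F w = md1_wait_cdf a D w"
  proof (cases "w < 0")
    case False
    define N where "N = nat \<lfloor>w / D\<rfloor>"
    have le: "real n * D \<le> w" if "n \<le> N" for n
    proof -
      have "real n \<le> w / D"
        using that False D_pos unfolding N_def by (metis le_nat_floor floor_of_nat of_nat_floor of_nat_le_iff order_trans divide_nonneg_pos not_less)
      then show ?thesis
        using D_pos by (simp add: pos_le_divide_eq)
    qed
    have "w / D \<le> real (Suc N)"
      unfolding N_def using False D_pos by (simp add: of_nat_nat) linarith
    then have "w \<le> real (Suc N) * D"
      using D_pos by (simp add: pos_divide_le_eq)
    then have "F w = exp (a * w) * (F 0 * (\<Sum>n\<le>N. exp (- a * real n * D) * (- a) ^ n / fact n * hinge_power n w))"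
      using damped_series[of w N] False by (simp add: F_eq_damped[of w])
    also have "\<dots> = (1 - a * D) * (\<Sum>n\<le>N. exp (a * (w - real n * D)) * (- a * (w - real n * D)) ^ n / fact n)"
      unfolding F_0 sum_distrib_left
    proof (intro sum.cong refl)
      fix n assume "n \<in> {..N}"
      then have "hinge_power n w = (w - real n * D) ^ n"
        using le[of n] by (simp add: hinge_power_def)
      moreover have "exp (a * (w - real n * D)) = exp (a * w) * exp (- a * real n * D)"
        by (simp add: exp_add[symmetric] algebra_simps)
      ultimately show "exp (a * w) * ((1 - a * D) * (exp (- a * real n * D) * (- a) ^ n / fact n * hinge_power n w))
          = (1 - a * D) * (exp (a * (w - real n * D)) * (- a * (w - real n * D)) ^ n / fact n)"
        by (simp only: power_mult_distrib) (simp add: mult_ac)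
    qed
    finally show ?thesis
      using False by (simp add: md1_wait_cdf_def N_def atLeast0AtMost)
  qed (simp add: md1_wait_cdf_def F_neg)
qed

section \<open>Integrals against the waiting time density\<close>

lemma md1_wait_pdf_eq:
  assumes "0 < w" "w \<noteq> D"
  shows "md1_wait_pdf a D w = a * F w - a * F (w - D)"
  using DERIV_imp_deriv[OF has_field_derivative_F[OF assms]]
  by (simp add: md1_wait_pdf_def flip: F_eq_cdf)

text \<open>At 0 and \<open>D\<close> the distribution function is not differentiable and
  \<open>deriv\<close> gives no information. Elsewhere the density is bounded by \<open>a\<close>,
  and \<open>\<phi>\<close> is bounded on the compact interval; hence the Lebesgue integral exists
  and agrees with the gauge integral \<open>I\<close>. The atom at 0 contributes
  \<open>\<phi> 0 * F 0\<close>.\<close>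

lemma md1_wait_pdf_integral_eq:
  assumes \<phi>: "continuous_on UNIV \<phi>" and "0 \<le> b"
    and I: "((\<lambda>w. \<phi> w * (a * F w - a * F (w - D))) has_integral I) {0..b}"
  shows "md1_wait_pdf_integral a D \<phi> b = \<phi> 0 * F 0 + I"
proof -
  have [measurable]: "\<phi> \<in> borel_measurable borel"
    using \<phi> by (rule borel_measurable_continuous_onI)
  let ?f = "\<lambda>w. \<phi> w * (a * F w - a * F (w - D))" and ?h = "\<lambda>w. \<phi> w * md1_wait_pdf a D w"
  have "compact (\<phi> ` {0..b})"
    using \<phi> by (intro compact_continuous_image) (auto intro: continuous_on_subset)
  then obtain B where "\<forall>y\<in>\<phi> ` {0..b}. norm y \<le> B"
    using compact_imp_bounded bounded_iff by blast
  then have B: "\<bar>\<phi> x\<bar> \<le> B" if "x \<in> {0..b}" for x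
    using that by auto
  have "\<bar>?f x\<bar> \<le> B * a" if "x \<in> {0..b}" for x
  proof -
    have "F (x - D) \<le> F x"
      using D_pos by (intro monoD[OF mono_F]) simp
    then have "\<bar>a * F x - a * F (x - D)\<bar> \<le> a * 1"
      unfolding right_diff_distrib[symmetric] abs_mult
      using a_pos F_nonneg[of "x - D"] F_le_1[of x] by (intro mult_mono) auto
    then show ?thesis
      using B[OF that] unfolding abs_mult by (intro mult_mono) auto
  qed
  then have f: "set_integrable lborel {0..b} ?f"
    by (rule set_integrable_bounded[rotated]) measurable
  \<comment> \<open>Agreement almost everywhere would not give Borel measurability, so the integrand
    is written out exactly, with its unknown values at 0 and \<open>D\<close> as constants.\<close>
  have "indicator {0..b} w *\<^sub>R ?h w =
      (if w = 0 then indicator {0..b} 0 *\<^sub>R ?h 0 else if w = D then indicator {0..b} D *\<^sub>R ?h D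
       else indicator {0..b} w *\<^sub>R ?f w)" for w
    by (auto simp: md1_wait_pdf_eq split: split_indicator)
  then have eq: "(\<lambda>w. indicator {0..b} w *\<^sub>R ?h w) = (\<lambda>w. if w = 0 then indicator {0..b} 0 *\<^sub>R ?h 0
      else if w = D then indicator {0..b} D *\<^sub>R ?h D else indicator {0..b} w *\<^sub>R ?f w)"
    by blast
  have "(\<lambda>w. indicator {0..b} w *\<^sub>R ?h w) \<in> borel_measurable borel"
    unfolding eq by measurable
  then have "(LBINT w:{0..b}. ?h w) = (LBINT w:{0..b}. ?f w)"
    unfolding set_lebesgue_integral_def
    using AE_lborel_singleton[of 0] AE_lborel_singleton[of D]
    by (intro integral_cong_AE) (auto simp: md1_wait_pdf_eq split: split_indicator)
  also have "\<dots> = I"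
    using set_borel_integral_eq_integral(2)[OF f] integral_unique[OF I] by simp
  finally show ?thesis
    by (simp add: md1_wait_pdf_integral_def flip: F_eq_cdf)
qed

lemma cdf_eq_md1_wait_pdf_integral:
  assumes "0 \<le> w"
  shows "md1_wait_pdf_integral a D (\<lambda>_. 1) w = F w"
  using md1_wait_pdf_integral_eq[of "\<lambda>_. 1" w "F w - F 0"] F_has_integral[OF assms] assms by simp

text \<open>Integration by parts with \<open>(w - b) * F w\<close>: the boundary term at
  \<open>b\<close> is 0, and the one at 0 cancels the contribution \<open>- b * F 0\<close> of the
  atom.\<close>

lemma md1_wait_pdf_integral_deficit:
  assumes "0 \<le> b"
  shows "md1_wait_pdf_integral a D (\<lambda>w. w - b) b = - integral {0..b} F"
proof -
  have "((\<lambda>w. F w + (w - b) * (a * F w - a * F (w - D))) has_integral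
      ((b - b) * F b - (0 - b) * F 0)) {0..b}"
    by (rule fundamental_theorem_of_calculus_interior_strong[of "{D}"])
      (use assms in \<open>auto simp flip: has_real_derivative_iff_has_vector_derivative
         intro!: derivative_eq_intros has_field_derivative_F continuous_intros
           continuous_on_subset[OF continuous_on_F]\<close>)
  from has_integral_diff[OF this integrable_integral[OF F_integrable_on[of 0 b]]]
  have "((\<lambda>w. (w - b) * (a * F w - a * F (w - D))) has_integral (b * F 0 - integral {0..b} F)) {0..b}"
    by simp
  from md1_wait_pdf_integral_eq[OF _ assms this] show ?thesis
    by (simp add: continuous_intros)
qed

section \<open>The survival function and the mean waiting time\<close>

definition survival :: "real \<Rightarrow> ennreal" where "survival s = ennreal (1 - F s)"

lemma survival_measurable [measurable]: "survival \<in> borel_measurable borel"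
  unfolding survival_def by measurable

lemma survival_neg: "s < 0 \<Longrightarrow> survival s = 1"
  by (simp add: survival_def F_neg)

lemma nn_integral_survival:
  "(\<integral>\<^sup>+s. survival s * indicator {x..y} s \<partial>lborel) = ennreal (integral {x..y} (\<lambda>s. 1 - F s))"
proof -
  have i: "set_integrable lborel {x..y} (\<lambda>s. 1 - F s)"
  proof (rule set_integrable_bounded)
    show "\<bar>1 - F s\<bar> \<le> 1" for s
      using F_nonneg[of s] F_le_1[of s] by linarith
  qed measurable
  have "(\<integral>\<^sup>+s. survival s * indicator {x..y} s \<partial>lborel) = (\<integral>\<^sup>+s. ennreal (indicator {x..y} s *\<^sub>R (1 - F s)) \<partial>lborel)"
    by (intro nn_integral_cong) (auto simp: survival_def split: split_indicator)
  also have "\<dots> = ennreal (LBINT s:{x..y}. 1 - F s)"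
    using i unfolding set_integrable_def set_lebesgue_integral_def
    by (intro nn_integral_eq_integral) (auto simp: F_le_1)
  finally show ?thesis
    using set_borel_integral_eq_integral(2)[OF i] by simp
qed

text \<open>This reads \<open>complement_eq\<close> as a convolution with the constant kernel
  \<open>a\<close> on \<open>{0..D}\<close>, whose total mass \<open>a * D\<close> is below 1. With
  values in \<open>ennreal\<close>, integrals can be exchanged before finiteness is known.\<close>

lemma survival_renewal:
  assumes "0 \<le> w"
  shows "survival w = (\<integral>\<^sup>+u. ennreal a * indicator {0..D} u * survival (w - u) \<partial>lborel)"
proof -
  have "survival w = ennreal a * (\<integral>\<^sup>+s. survival s * indicator {w - D..w} s \<partial>lborel)"
    unfolding nn_integral_survival using complement_eq[OF assms] a_pos
    by (simp add: survival_def ennreal_mult')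
  also have "\<dots> = (\<integral>\<^sup>+s. ennreal a * (survival s * indicator {w - D..w} s) \<partial>lborel)"
    by (rule nn_integral_cmult[symmetric]) measurable
  also have "\<dots> = (\<integral>\<^sup>+u. ennreal a * indicator {0..D} u * survival (w - u) \<partial>lborel)"
    by (subst nn_integral_real_affine[where c="-1" and t=w])
      (auto intro!: nn_integral_cong split: split_indicator)
  finally show ?thesis .
qed

text \<open>The set \<open>B\<close> is first an initial segment, where the mass is known to be finite, so that the renewal
  equation bounds it; only then is \<open>B\<close> the whole line and the equation solved for the mass.\<close>

definition survival_mass :: "real set \<Rightarrow> ennreal" where
  "survival_mass B = (\<integral>\<^sup>+w. survival w * indicator {0..} w * indicator B w \<partial>lborel)"

text \<open>Tonelli's theorem and the shift \<open>s = w - u\<close>, under which the condition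
  \<open>0 \<le> w\<close> becomes \<open>- u \<le> s\<close>.\<close>

lemma survival_mass_renewal:
  assumes [measurable]: "B \<in> sets borel"
  shows "survival_mass B = (\<integral>\<^sup>+u. ennreal a * indicator {0..D} u *
    (\<integral>\<^sup>+s. survival s * indicator {- u..} s * indicator B (s + u) \<partial>lborel) \<partial>lborel)"
proof -
  have "survival_mass B = (\<integral>\<^sup>+w. \<integral>\<^sup>+u. ennreal a * indicator {0..D} u * survival (w - u) * indicator {0..} w * indicator B w \<partial>lborel \<partial>lborel)"
    unfolding survival_mass_def
    by (intro nn_integral_cong) (auto simp: survival_renewal nn_integral_multc split: split_indicator)
  also have "\<dots> = (\<integral>\<^sup>+u. \<integral>\<^sup>+w. ennreal a * indicator {0..D} u * survival (w - u) * indicator {0..} w * indicator B w \<partial>lborel \<partial>lborel)"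
    by (rule lborel_pair.Fubini') measurable
  also have "\<dots> = (\<integral>\<^sup>+u. \<integral>\<^sup>+s. ennreal a * indicator {0..D} u * (survival s * indicator {- u..} s * indicator B (s + u)) \<partial>lborel \<partial>lborel)"
  proof (rule nn_integral_cong)
    fix u
    show "(\<integral>\<^sup>+w. ennreal a * indicator {0..D} u * survival (w - u) * indicator {0..} w * indicator B w \<partial>lborel)
      = (\<integral>\<^sup>+s. ennreal a * indicator {0..D} u * (survival s * indicator {- u..} s * indicator B (s + u)) \<partial>lborel)"
      by (subst nn_integral_real_affine[where c=1 and t=u])
        (auto intro!: nn_integral_cong simp: add_ac split: split_indicator)
  qed
  also have "\<dots> = (\<integral>\<^sup>+u. ennreal a * indicator {0..D} u *
    (\<integral>\<^sup>+s. survival s * indicator {- u..} s * indicator B (s + u) \<partial>lborel) \<partial>lborel)"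
    by (intro nn_integral_cong nn_integral_cmult) measurable
  finally show ?thesis .
qed

text \<open>In the applications \<open>u\<close> is the mass over \<open>{- u..<0}\<close>, where
  \<open>survival\<close> is 1, and \<open>c\<close> is the mass over the nonnegative
  half-line.\<close>

lemma nn_integral_ramp:
  "(\<integral>\<^sup>+u. ennreal a * indicator {0..D} u * (ennreal u + c) \<partial>lborel) = ennreal (a * D\<^sup>2 / 2) + ennreal (a * D) * c"
proof -
  have "(\<integral>\<^sup>+u. ennreal a * indicator {0..D} u * (ennreal u + c) \<partial>lborel)
    = (\<integral>\<^sup>+u. ennreal a * (ennreal u * indicator {0..D} u) + ennreal a * c * indicator {0..D} u \<partial>lborel)"
    by (intro nn_integral_cong) (auto simp: algebra_simps split: split_indicator)
  also have "\<dots> = ennreal a * (\<integral>\<^sup>+u. ennreal u * indicator {0..D} u \<partial>lborel) + ennreal a * c * ennreal D"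
    using D_pos by (simp add: nn_integral_add nn_integral_cmult nn_integral_cmult_indicator)
  also have "(\<integral>\<^sup>+u. ennreal u * indicator {0..D} u \<partial>lborel) = ennreal (D\<^sup>2 / 2 - 0\<^sup>2 / 2)"
    using D_pos by (intro nn_integral_FTC_Icc) (auto intro!: derivative_eq_intros)
  finally have "(\<integral>\<^sup>+u. ennreal a * indicator {0..D} u * (ennreal u + c) \<partial>lborel)
      = ennreal a * ennreal (D\<^sup>2 / 2) + ennreal a * ennreal D * c"
    by (simp add: mult_ac)
  then show ?thesis
    using a_pos by (simp flip: ennreal_mult')
qed

lemma survival_mass_split:
  assumes "0 \<le> u" and [measurable]: "B \<in> sets borel"
  shows "(\<integral>\<^sup>+s. survival s * indicator {- u..} s * indicator B s \<partial>lborel)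
    = emeasure lborel ({- u..<0} \<inter> B) + survival_mass B"
proof -
  have "(\<integral>\<^sup>+s. survival s * indicator {- u..} s * indicator B s \<partial>lborel)
    = (\<integral>\<^sup>+s. indicator ({- u..<0} \<inter> B) s + survival s * indicator {0..} s * indicator B s \<partial>lborel)"
    using assms by (intro nn_integral_cong) (auto simp: survival_neg split: split_indicator)
  also have "\<dots> = emeasure lborel ({- u..<0} \<inter> B) + survival_mass B"
    by (simp add: nn_integral_add survival_mass_def)
  finally show ?thesis .
qed

text \<open>For \<open>u \<ge> 0\<close> the condition \<open>s + u \<le> N\<close> implies
  \<open>s \<le> N\<close>, so the renewal equation becomes
  \<open>J \<le> a * D^2 / 2 + a * D * J\<close>. The truncated mass is at most \<open>N\<close>, so
  this may be solved for \<open>J\<close>, with a bound independent of \<open>N\<close>.\<close>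

lemma survival_mass_finite: "survival_mass {..real N} \<le> ennreal (D * (a * D) / (2 * (1 - a * D)))"
proof -
  let ?J = "survival_mass {..real N}"
  have "?J \<le> (\<integral>\<^sup>+w. indicator {0..real N} w \<partial>lborel)"
    unfolding survival_mass_def
    by (intro nn_integral_mono) (auto simp: survival_def F_nonneg split: split_indicator)
  then have fin: "?J < \<infinity>"
    by (simp add: order_le_less_trans)
  have "?J = (\<integral>\<^sup>+u. ennreal a * indicator {0..D} u *
    (\<integral>\<^sup>+s. survival s * indicator {- u..} s * indicator {..real N} (s + u) \<partial>lborel) \<partial>lborel)"
    by (rule survival_mass_renewal) simp
  also have "\<dots> \<le> (\<integral>\<^sup>+u. ennreal a * indicator {0..D} u * (ennreal u + ?J) \<partial>lborel)"
  proof (rule nn_integral_mono)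
    fix u :: real
    show "ennreal a * indicator {0..D} u *
        (\<integral>\<^sup>+s. survival s * indicator {- u..} s * indicator {..real N} (s + u) \<partial>lborel)
      \<le> ennreal a * indicator {0..D} u * (ennreal u + ?J)"
    proof (cases "0 \<le> u")
      case True
      have "(\<integral>\<^sup>+s. survival s * indicator {- u..} s * indicator {..real N} (s + u) \<partial>lborel)
        \<le> (\<integral>\<^sup>+s. survival s * indicator {- u..} s * indicator {..real N} s \<partial>lborel)"
        using True by (intro nn_integral_mono) (auto split: split_indicator)
      also have "\<dots> = emeasure lborel ({- u..<0} \<inter> {..real N}) + ?J"
        by (rule survival_mass_split[OF True]) simp
      also have "{- u..<0} \<inter> {..real N} = {- u..<0}"
        by auto
      finally show ?thesis
        using True by (intro mult_left_mono) auto
    qed simp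
  qed
  also have "\<dots> = ennreal (a * D\<^sup>2 / 2) + ennreal (a * D) * ?J"
    by (rule nn_integral_ramp)
  finally have le: "?J \<le> ennreal (a * D\<^sup>2 / 2) + ennreal (a * D) * ?J" .
  obtain r where r: "?J = ennreal r" "0 \<le> r"
    using fin by (cases ?J) auto
  have "r \<le> a * D\<^sup>2 / 2 + a * D * r"
    using le a_pos D_pos r by (simp flip: ennreal_mult ennreal_plus)
  then have "r \<le> D * (a * D) / (2 * (1 - a * D))"
    using load by (simp add: field_simps power2_eq_square)
  then show ?thesis
    using r by (simp add: ennreal_leI)
qed

text \<open>The value is the Pollaczek-Khinchine mean waiting time. Monotone convergence carries the
  uniform bound over to the whole half-line, and the renewal equation can then be solved in the
  reals.\<close>

lemma survival_mass_UNIV: "survival_mass UNIV = ennreal (D * (a * D) / (2 * (1 - a * D)))"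
proof -
  have "survival_mass UNIV = (SUP N. survival_mass {..real N})"
    unfolding survival_mass_def
  proof (subst nn_integral_monotone_convergence_SUP[symmetric])
    show "incseq (\<lambda>N w. survival w * indicator {0..} w * indicator {..real N} w)"
      by (auto simp: incseq_def le_fun_def split: split_indicator)
    show "(\<integral>\<^sup>+w. survival w * indicator {0..} w * indicator UNIV w \<partial>lborel)
      = (\<integral>\<^sup>+w. (SUP N. survival w * indicator {0..} w * indicator {..real N} w) \<partial>lborel)"
    proof (rule nn_integral_cong)
      fix w :: real
      obtain N :: nat where N: "w \<le> real N"
        using real_arch_simple by blast
      show "survival w * indicator {0..} w * indicator UNIV w = (SUP N. survival w * indicator {0..} w * indicator {..real N} w)"
        by (rule antisym[OF SUP_upper2[of N] SUP_least]) (use N in \<open>auto split: split_indicator\<close>)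
    qed
  qed measurable
  also have "\<dots> \<le> ennreal (D * (a * D) / (2 * (1 - a * D)))"
    by (intro SUP_least survival_mass_finite)
  finally have "survival_mass UNIV < \<infinity>"
    by (simp add: order_le_less_trans)
  then obtain r where r: "survival_mass UNIV = ennreal r" "0 \<le> r"
    by (cases "survival_mass UNIV") auto
  have "survival_mass UNIV = (\<integral>\<^sup>+u. ennreal a * indicator {0..D} u *
    (\<integral>\<^sup>+s. survival s * indicator {- u..} s * indicator UNIV (s + u) \<partial>lborel) \<partial>lborel)"
    by (rule survival_mass_renewal) simp
  also have "\<dots> = (\<integral>\<^sup>+u. ennreal a * indicator {0..D} u * (ennreal u + survival_mass UNIV) \<partial>lborel)"
  proof (intro nn_integral_cong)
    fix u :: real
    show "ennreal a * indicator {0..D} u *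
        (\<integral>\<^sup>+s. survival s * indicator {- u..} s * indicator UNIV (s + u) \<partial>lborel)
      = ennreal a * indicator {0..D} u * (ennreal u + survival_mass UNIV)"
      using survival_mass_split[of u UNIV] by (cases "0 \<le> u") auto
  qed
  also have "\<dots> = ennreal (a * D\<^sup>2 / 2) + ennreal (a * D) * survival_mass UNIV"
    by (rule nn_integral_ramp)
  finally have "r = a * D\<^sup>2 / 2 + a * D * r"
    using a_pos D_pos r by (simp flip: ennreal_mult ennreal_plus)
  then have "r = D * (a * D) / (2 * (1 - a * D))"
    using load by (simp add: field_simps power2_eq_square)
  then show ?thesis
    using r by simp
qed

text \<open>For \<open>x < D\<close> the tail exceeds the mean waiting time by \<open>D - x\<close>,
  since \<open>survival\<close> is 1 on the negatives. Otherwise it is the mean waiting time less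
  the integral of \<open>1 - F\<close> over \<open>{0..x - D}\<close>, which
  \<open>md1_wait_pdf_integral_deficit\<close> matches with the kernel. Nonnegativity is recorded
  separately because \<open>ennreal\<close> would hide a negative value.\<close>

lemma tail_eq_wait_kernel:
  assumes x: "(\<Sum>j=1..k. y j) = x"
  shows "(\<integral>\<^sup>+t. survival t * indicator {x - D..} t \<partial>lborel) = ennreal (wait_kernel a D k y)"
    and "0 \<le> wait_kernel a D k y"
proof -
  let ?J = "D * (a * D) / (2 * (1 - a * D))" and ?b = "x - D"
  have J: "0 \<le> ?J"
    using a_pos D_pos load by simp
  have *: "(\<integral>\<^sup>+t. survival t * indicator {?b..} t \<partial>lborel) = ennreal (wait_kernel a D k y) \<and> 0 \<le> wait_kernel a D k y"
  proof (cases "?b < 0")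
    case True
    have "(\<integral>\<^sup>+t. survival t * indicator {?b..} t \<partial>lborel) = ennreal (- ?b) + ennreal ?J"
      using survival_mass_split[of "- ?b" UNIV] survival_mass_UNIV True by simp
    also have "\<dots> = ennreal (- ?b + ?J)"
      using True J by (intro ennreal_plus[symmetric]) auto
    also have "- ?b + ?J = wait_kernel a D k y"
      using True by (simp add: wait_kernel_def[of a D k y, unfolded x])
    finally show ?thesis
      using True J by (auto simp: wait_kernel_def[of a D k y, unfolded x])
  next
    case False
    define I where "I = integral {0..?b} F"
    have I: "integral {0..?b} (\<lambda>s. 1 - F s) = ?b - I"
      unfolding I_def using False by (subst Henstock_Kurzweil_Integration.integral_diff) auto
    have "ennreal ?J = (\<integral>\<^sup>+t. survival t * indicator {0..} t \<partial>lborel)"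
      using survival_mass_UNIV by (simp add: survival_mass_def)
    also have "\<dots> = (\<integral>\<^sup>+t. survival t * indicator {0..?b} t + survival t * indicator {?b..} t \<partial>lborel)"
      using False AE_lborel_singleton[of ?b]
      by (intro nn_integral_cong_AE) (auto split: split_indicator)
    also have "\<dots> = ennreal (?b - I) + (\<integral>\<^sup>+t. survival t * indicator {?b..} t \<partial>lborel)"
      by (simp add: nn_integral_add nn_integral_survival I)
    finally have split: "ennreal ?J = ennreal (?b - I) + (\<integral>\<^sup>+t. survival t * indicator {?b..} t \<partial>lborel)" .
    then obtain r where r: "(\<integral>\<^sup>+t. survival t * indicator {?b..} t \<partial>lborel) = ennreal r" "0 \<le> r"
      by (cases "\<integral>\<^sup>+t. survival t * indicator {?b..} t \<partial>lborel") auto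
    have "0 \<le> ?b - I"
      unfolding I[symmetric] by (intro integral_nonneg) (auto simp: F_le_1 intro: integrable_diff)
    then have "?J = ?b - I + r"
      using split r J by (simp flip: ennreal_plus)
    moreover have "wait_kernel a D k y = ?J - ?b + I"
    proof -
      have "(\<lambda>w. w + D - x) = (\<lambda>w. w - ?b)"
        by auto
      then show ?thesis
        using False md1_wait_pdf_integral_deficit[of ?b]
        by (simp add: wait_kernel_def[of a D k y, unfolded x] I_def)
    qed
    ultimately show ?thesis
      using r by simp
  qed
  show "(\<integral>\<^sup>+t. survival t * indicator {x - D..} t \<partial>lborel) = ennreal (wait_kernel a D k y)"
    using * by (rule conjunct1)
  show "0 \<le> wait_kernel a D k y"
    using * by (rule conjunct2)
qed

end

subsection \<open>The law of a polling cycle\<close>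

text \<open>The two independence assumptions together give \<open>U\<close>, \<open>K\<close> and
  the hop sequence a product law. \<open>steady_state\<close> says that the system time at the end
  of the cycle is distributed as the one at its start.\<close>

locale polling_cycle = prob_space M
  for M :: "'a measure" +
  fixes lam p D :: real and U :: "'a \<Rightarrow> real" and K :: "'a \<Rightarrow> nat" and Y :: "nat \<Rightarrow> 'a \<Rightarrow> real"
  assumes lam_pos: "0 < lam" and p_pos: "0 < p" and p_le_1: "p \<le> 1"
    and D_pos: "0 < D" and load: "p * lam * D < 1"
    and hops_indep: "indep_vars (\<lambda>_. borel) Y {1..}"
    and hops_exponential: "\<And>j. j \<ge> 1 \<Longrightarrow> distributed M lborel (Y j) (exponential_density lam)"
    and K_geometric: "\<And>n. n \<ge> 1 \<Longrightarrow> measure M {\<omega> \<in> space M. K \<omega> = n} = p * (1 - p) ^ (n - 1)"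
    and K_indep: "indep_rv M (count_space UNIV) K
        (\<Pi>\<^sub>M j\<in>{1..}. borel) (\<lambda>\<omega>. \<lambda>j\<in>{1..}. Y j \<omega>)"
    and U_indep: "indep_rv M borel U
        (count_space UNIV \<Otimes>\<^sub>M (\<Pi>\<^sub>M j\<in>{1..}. borel)) (\<lambda>\<omega>. (K \<omega>, \<lambda>j\<in>{1..}. Y j \<omega>))"
    and steady_state: "distr M borel (system_time D U K Y) = distr M borel U"
begin

text \<open>The simplifier turns \<open>{1..}\<close> into \<open>{Suc 0..}\<close>, hence this form of the index set.\<close>

abbreviation hop_space :: "(nat \<Rightarrow> real) measure" where
  "hop_space \<equiv> \<Pi>\<^sub>M j\<in>{Suc 0..}. borel"

text \<open>The whole sequence is one random element of a product space, so that its independence of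
  \<open>K\<close> and \<open>U\<close> is a statement about product measures.\<close>

definition hops :: "'a \<Rightarrow> nat \<Rightarrow> real" where
  "hops \<omega> = (\<lambda>j\<in>{1..}. Y j \<omega>)"

lemma hops_apply [simp]: "1 \<le> j \<Longrightarrow> hops \<omega> j = Y j \<omega>"
  by (simp add: hops_def)

lemma sum_hops [simp]: "sum (hops \<omega>) {Suc 0..k} = (\<Sum>j=Suc 0..k. Y j \<omega>)"
  by (intro sum.cong) auto

lemma U_measurable [measurable]: "U \<in> borel_measurable M"
  and K_measurable [measurable]: "K \<in> measurable M (count_space UNIV)"
  and hops_measurable [measurable]: "hops \<in> measurable M hop_space"
proof -
  have "hops = (\<lambda>\<omega>. \<lambda>j\<in>{1..}. Y j \<omega>)"
    by (simp add: hops_def[abs_def])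
  then show "hops \<in> measurable M hop_space"
    using K_indep unfolding indep_rv_def by simp
  show "U \<in> borel_measurable M" "K \<in> measurable M (count_space UNIV)"
    using U_indep K_indep unfolding indep_rv_def by blast+
qed

lemma Y_measurable [measurable]: "1 \<le> j \<Longrightarrow> Y j \<in> borel_measurable M"
  by (drule hops_exponential[THEN distributed_measurable]) simp

section \<open>Product law of the cycle and conditioning on the number of hops\<close>

lemma distr_joint:
  "distr M (borel \<Otimes>\<^sub>M (count_space UNIV \<Otimes>\<^sub>M hop_space)) (\<lambda>\<omega>. (U \<omega>, K \<omega>, hops \<omega>))
    = distr M borel U \<Otimes>\<^sub>M (distr M (count_space UNIV) K \<Otimes>\<^sub>M distr M hop_space hops)"
  using U_indep K_indep by (simp add: indep_rv_def hops_def[abs_def])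

text \<open>Independence in working form: \<open>U\<close>, \<open>K\<close> and \<open>hops\<close>
  each receive their own integration variable over \<open>M\<close>.\<close>

lemma nn_integral_joint:
  assumes [measurable]: "f \<in> borel_measurable (borel \<Otimes>\<^sub>M (count_space UNIV \<Otimes>\<^sub>M hop_space))"
  shows "(\<integral>\<^sup>+\<omega>. f (U \<omega>, K \<omega>, hops \<omega>) \<partial>M) = (\<integral>\<^sup>+u. \<integral>\<^sup>+\<omega>k. \<integral>\<^sup>+\<omega>. f (U u, K \<omega>k, hops \<omega>) \<partial>M \<partial>M \<partial>M)"
proof -
  interpret dK: prob_space "distr M (count_space UNIV) K"
    by (rule prob_space_distr) simp
  interpret dY: prob_space "distr M hop_space hops"
    by (rule prob_space_distr) simp
  interpret KY: pair_prob_space "distr M (count_space UNIV) K" "distr M hop_space hops" ..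
  have "(\<integral>\<^sup>+\<omega>. f (U \<omega>, K \<omega>, hops \<omega>) \<partial>M)
    = integral\<^sup>N (distr M (borel \<Otimes>\<^sub>M (count_space UNIV \<Otimes>\<^sub>M hop_space)) (\<lambda>\<omega>. (U \<omega>, K \<omega>, hops \<omega>))) f"
    by (subst nn_integral_distr) auto
  also have "\<dots> = (\<integral>\<^sup>+u. \<integral>\<^sup>+x. f (u, x) \<partial>(distr M (count_space UNIV) K \<Otimes>\<^sub>M distr M hop_space hops) \<partial>distr M borel U)"
    unfolding distr_joint by (subst KY.nn_integral_fst) auto
  also have "\<dots> = (\<integral>\<^sup>+u. \<integral>\<^sup>+k. \<integral>\<^sup>+y. f (u, k, y) \<partial>distr M hop_space hops \<partial>distr M (count_space UNIV) K \<partial>distr M borel U)"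
    by (subst dY.nn_integral_fst[symmetric]) auto
  also have "\<dots> = (\<integral>\<^sup>+u. \<integral>\<^sup>+\<omega>k. \<integral>\<^sup>+\<omega>. f (U u, K \<omega>k, hops \<omega>) \<partial>M \<partial>M \<partial>M)"
    by (simp add: nn_integral_distr)
  finally show ?thesis .
qed

text \<open>The variable of \<open>K\<close> integrates to 1. The order is chosen so that the inner
  integral runs over \<open>U\<close> with the hops fixed.\<close>

lemma nn_integral_U_hops:
  assumes [measurable]: "case_prod g \<in> borel_measurable (borel \<Otimes>\<^sub>M hop_space)"
  shows "(\<integral>\<^sup>+\<omega>. g (U \<omega>) (hops \<omega>) \<partial>M) = (\<integral>\<^sup>+\<omega>. \<integral>\<^sup>+u. g (U u) (hops \<omega>) \<partial>M \<partial>M)"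
proof -
  interpret MM: pair_prob_space M M ..
  have "(\<integral>\<^sup>+\<omega>. g (U \<omega>) (hops \<omega>) \<partial>M) = (\<integral>\<^sup>+u. \<integral>\<^sup>+\<omega>. g (U u) (hops \<omega>) \<partial>M \<partial>M)"
    using nn_integral_joint[of "\<lambda>(u, k, y). g u y"] by (simp add: emeasure_space_1)
  then show ?thesis
    by (simp add: MM.Fubini'[of "\<lambda>u \<omega>. g (U u) (hops \<omega>)"])
qed

lemma nn_integral_K_eq:
  assumes [measurable]: "case_prod g \<in> borel_measurable (borel \<Otimes>\<^sub>M hop_space)"
  shows "(\<integral>\<^sup>+\<omega>. indicator {k} (K \<omega>) * g (U \<omega>) (hops \<omega>) \<partial>M)
    = ennreal (prob {\<omega> \<in> space M. K \<omega> = k}) * (\<integral>\<^sup>+\<omega>. g (U \<omega>) (hops \<omega>) \<partial>M)"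
proof -
  have [measurable]: "(indicator {k} :: nat \<Rightarrow> ennreal) \<in> borel_measurable (count_space UNIV)"
    by simp
  have "(\<integral>\<^sup>+\<omega>. indicator {k} (K \<omega>) * g (U \<omega>) (hops \<omega>) \<partial>M)
    = (\<integral>\<^sup>+u. \<integral>\<^sup>+\<omega>k. \<integral>\<^sup>+\<omega>. indicator {k} (K \<omega>k) * g (U u) (hops \<omega>) \<partial>M \<partial>M \<partial>M)"
    using nn_integral_joint[of "\<lambda>(u, k', y). indicator {k} k' * g u y"] by simp
  also have "\<dots> = (\<integral>\<^sup>+u. (\<integral>\<^sup>+\<omega>k. indicator {k} (K \<omega>k) \<partial>M) * (\<integral>\<^sup>+\<omega>. g (U u) (hops \<omega>) \<partial>M) \<partial>M)"
    by (simp add: nn_integral_cmult nn_integral_multc)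
  also have "(\<integral>\<^sup>+\<omega>k. indicator {k} (K \<omega>k) \<partial>M) = (\<integral>\<^sup>+\<omega>k. indicator {\<omega> \<in> space M. K \<omega> = k} \<omega>k \<partial>M)"
    by (intro nn_integral_cong) (auto split: split_indicator)
  also have "\<dots> = ennreal (prob {\<omega> \<in> space M. K \<omega> = k})"
    by (simp add: emeasure_eq_measure)
  also have "(\<integral>\<^sup>+u. ennreal (prob {\<omega> \<in> space M. K \<omega> = k}) * (\<integral>\<^sup>+\<omega>. g (U u) (hops \<omega>) \<partial>M) \<partial>M)
    = ennreal (prob {\<omega> \<in> space M. K \<omega> = k}) * (\<integral>\<^sup>+\<omega>. g (U \<omega>) (hops \<omega>) \<partial>M)"
    using nn_integral_joint[of "\<lambda>(u, k, y). g u y"] by (simp add: nn_integral_cmult emeasure_space_1)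
  finally show ?thesis .
qed

lemma nn_integral_split_K:
  assumes [measurable]: "\<And>k. f k \<in> borel_measurable M"
  shows "(\<integral>\<^sup>+\<omega>. f (K \<omega>) \<omega> \<partial>M) = (\<Sum>k. \<integral>\<^sup>+\<omega>. indicator {k} (K \<omega>) * f k \<omega> \<partial>M)"
proof -
  have "(\<integral>\<^sup>+\<omega>. f (K \<omega>) \<omega> \<partial>M) = (\<integral>\<^sup>+\<omega>. (\<Sum>k. indicator {k} (K \<omega>) * f k \<omega>) \<partial>M)"
  proof (intro nn_integral_cong)
    fix \<omega>
    have "(\<Sum>k. indicator {k} (K \<omega>) * f k \<omega>) = (\<Sum>k\<in>{K \<omega>}. indicator {k} (K \<omega>) * f k \<omega>)"
      by (rule suminf_finite) auto
    then show "f (K \<omega>) \<omega> = (\<Sum>k. indicator {k} (K \<omega>) * f k \<omega>)"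
      by simp
  qed
  also have "\<dots> = (\<Sum>k. \<integral>\<^sup>+\<omega>. indicator {k} (K \<omega>) * f k \<omega> \<partial>M)"
    by (intro nn_integral_suminf borel_measurable_times_ennreal assms measurable_compose[OF K_measurable]) simp
  finally show ?thesis .
qed

lemma geometric_weights_sums: "(\<lambda>n. p * (1 - p) ^ n) sums 1"
proof -
  have "norm (1 - p) < 1"
    using p_pos p_le_1 by simp
  from sums_mult[OF geometric_sums[OF this], of p] show ?thesis
    using p_pos by simp
qed

text \<open>The geometric weights on the positive integers already add up to 1.\<close>

lemma prob_K_0: "prob {\<omega> \<in> space M. K \<omega> = 0} = 0"
proof -
  let ?P = "\<lambda>k. prob {\<omega> \<in> space M. K \<omega> = k}"
  have P: "?P (n + 1) = p * (1 - p) ^ n" for n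
    using K_geometric[of "n + 1"] by simp
  have "1 = (\<integral>\<^sup>+\<omega>. 1 \<partial>M)"
    by (simp add: emeasure_space_1)
  also have "\<dots> = (\<Sum>k. \<integral>\<^sup>+\<omega>. indicator {k} (K \<omega>) * 1 \<partial>M)"
    using nn_integral_split_K[of "\<lambda>_ _. 1"] by simp
  also have "\<dots> = (\<Sum>k. ennreal (prob {\<omega> \<in> space M. K \<omega> = k}))"
    using nn_integral_K_eq[of "\<lambda>_ _. 1"] by (simp add: emeasure_space_1)
  also have "\<dots> = (\<Sum>n. ennreal (?P (n + 1))) + (\<Sum>k<1. ennreal (?P k))"
    by (rule suminf_offset) simp
  also have "(\<Sum>n. ennreal (?P (n + 1))) = ennreal 1"
    unfolding P using geometric_weights_sums p_pos p_le_1 by (intro suminf_ennreal_eq) auto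
  finally have "ennreal 1 = ennreal (1 + ?P 0)"
    by (simp add: ennreal_plus)
  then have "1 = 1 + ?P 0"
    by (subst (asm) ennreal_inj) simp_all
  then show ?thesis
    by linarith
qed

text \<open>Conditioning on \<open>K\<close>, indexed by \<open>n = K - 1\<close>; the case
  \<open>K = 0\<close> has probability 0.\<close>

lemma nn_integral_mixture:
  assumes [measurable]: "\<And>k. case_prod (f k) \<in> borel_measurable (borel \<Otimes>\<^sub>M hop_space)"
  shows "(\<integral>\<^sup>+\<omega>. f (K \<omega>) (U \<omega>) (hops \<omega>) \<partial>M)
    = (\<Sum>n. ennreal (p * (1 - p) ^ n) * (\<integral>\<^sup>+\<omega>. f (Suc n) (U \<omega>) (hops \<omega>) \<partial>M))"
proof -
  have "(\<integral>\<^sup>+\<omega>. f (K \<omega>) (U \<omega>) (hops \<omega>) \<partial>M)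
    = (\<Sum>k. ennreal (prob {\<omega> \<in> space M. K \<omega> = k}) * (\<integral>\<^sup>+\<omega>. f k (U \<omega>) (hops \<omega>) \<partial>M))"
    by (subst nn_integral_split_K[of "\<lambda>k \<omega>. f k (U \<omega>) (hops \<omega>)"]) (measurable, simp add: nn_integral_K_eq[OF assms])
  also have "\<dots> = (\<Sum>n. ennreal (p * (1 - p) ^ n) * (\<integral>\<^sup>+\<omega>. f (Suc n) (U \<omega>) (hops \<omega>) \<partial>M))"
    using suminf_offset[of "\<lambda>k. ennreal (prob {\<omega> \<in> space M. K \<omega> = k}) * (\<integral>\<^sup>+\<omega>. f k (U \<omega>) (hops \<omega>) \<partial>M)" 1]
    by (simp add: K_geometric prob_K_0)
  finally show ?thesis .
qed

text \<open>The terms \<open>((1 - p) * lam * x)^n / n!\<close> sum to an exponential, which lowers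
  the rate from \<open>lam\<close> to \<open>p * lam\<close>. This is the thinning of a Poisson
  process.\<close>

lemma erlang_mixture:
  "(\<Sum>n. ennreal (p * (1 - p) ^ n) * ennreal (erlang_density n lam x)) = ennreal (exponential_density (p * lam) x)"
proof (cases "x < 0")
  case False
  have "(\<lambda>n. p * lam * exp (- lam * x) * (((1 - p) * (lam * x)) ^ n /\<^sub>R fact n)) sums
      (p * lam * exp (- lam * x) * exp ((1 - p) * (lam * x)))"
    by (rule sums_mult[OF exp_converges])
  moreover have "p * lam * exp (- lam * x) * (((1 - p) * (lam * x)) ^ n /\<^sub>R fact n)
      = p * (1 - p) ^ n * erlang_density n lam x" for n
    using False by (simp add: erlang_density_def power_mult_distrib divide_inverse)
  moreover have "p * lam * exp (- lam * x) * exp ((1 - p) * (lam * x)) = exponential_density (p * lam) x"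
    using False by (simp add: exponential_density_def exp_add[symmetric] algebra_simps)
  ultimately have "(\<lambda>n. p * (1 - p) ^ n * erlang_density n lam x) sums exponential_density (p * lam) x"
    by (simp only:)
  then have "(\<Sum>n. ennreal (p * (1 - p) ^ n * erlang_density n lam x)) = ennreal (exponential_density (p * lam) x)"
    using lam_pos p_pos p_le_1 by (intro suminf_ennreal_eq) auto
  then show ?thesis
    using p_pos p_le_1 by (simp add: ennreal_mult')
next
  case True
  then have "erlang_density n l x = 0" for n l
    by (simp add: erlang_density_def)
  then show ?thesis
    by (simp only: ennreal_0 mult_zero_right suminf_zero)
qed

text \<open>The index of \<open>erlang_density\<close> is one less than the number of
  summands.\<close>

lemma partial_sum_distributed:
  "distributed M lborel (\<lambda>\<omega>. \<Sum>j=1..Suc n. Y j \<omega>) (erlang_density n lam)"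
proof -
  have card: "card {1..Suc n} - 1 = n"
    by simp
  have "distributed M lborel (\<lambda>\<omega>. \<Sum>j\<in>{1..Suc n}. Y j \<omega>) (erlang_density (card {1..Suc n} - 1) lam)"
  proof (rule exponential_distributed_sum)
    show "indep_vars (\<lambda>_. borel) Y {1..Suc n}"
      by (rule indep_vars_subset[OF hops_indep]) auto
    show "distributed M lborel (Y j) (exponential_density lam)" if "j \<in> {1..Suc n}" for j
      by (rule hops_exponential) (use that in simp)
  qed (simp_all add: lam_pos)
  then show ?thesis
    unfolding card .
qed

lemma nn_integral_interarrival:
  assumes [measurable]: "\<phi> \<in> borel_measurable borel"
  shows "(\<integral>\<^sup>+\<omega>. \<phi> (interarrival K Y \<omega>) \<partial>M)
    = (\<integral>\<^sup>+x. ennreal (exponential_density (p * lam) x) * \<phi> x \<partial>lborel)"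
proof -
  have "(\<integral>\<^sup>+\<omega>. \<phi> (interarrival K Y \<omega>) \<partial>M) = (\<integral>\<^sup>+\<omega>. \<phi> (\<Sum>j=1..K \<omega>. hops \<omega> j) \<partial>M)"
    by (simp add: interarrival_def)
  also have "\<dots> = (\<Sum>n. ennreal (p * (1 - p) ^ n) * (\<integral>\<^sup>+\<omega>. \<phi> (\<Sum>j=1..Suc n. hops \<omega> j) \<partial>M))"
    by (rule nn_integral_mixture[of "\<lambda>k u y. \<phi> (\<Sum>j=1..k. y j)"]) measurable
  also have "\<dots> = (\<Sum>n. ennreal (p * (1 - p) ^ n) * (\<integral>\<^sup>+x. ennreal (erlang_density n lam x) * \<phi> x \<partial>lborel))"
    by (subst distributed_nn_integral[OF partial_sum_distributed]) simp_all
  also have "\<dots> = (\<Sum>n. \<integral>\<^sup>+x. ennreal (p * (1 - p) ^ n) * (ennreal (erlang_density n lam x) * \<phi> x) \<partial>lborel)"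
    by (subst nn_integral_cmult) auto
  also have "\<dots> = (\<integral>\<^sup>+x. (\<Sum>n. ennreal (p * (1 - p) ^ n) * (ennreal (erlang_density n lam x) * \<phi> x)) \<partial>lborel)"
    by (rule nn_integral_suminf[symmetric]) measurable
  also have "\<dots> = (\<integral>\<^sup>+x. ennreal (exponential_density (p * lam) x) * \<phi> x \<partial>lborel)"
    by (simp add: mult.assoc[symmetric] erlang_mixture[symmetric])
  finally show ?thesis .
qed

text \<open>For each fixed number of hops \<open>U\<close> is separated from their sum; the mixture
  formula, read backwards, then restores the random number \<open>K\<close>.\<close>

lemma nn_integral_U_interarrival:
  assumes [measurable]: "case_prod g \<in> borel_measurable (borel \<Otimes>\<^sub>M borel)"
  shows "(\<integral>\<^sup>+\<omega>. g (U \<omega>) (interarrival K Y \<omega>) \<partial>M)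
    = (\<integral>\<^sup>+x. ennreal (exponential_density (p * lam) x) * (\<integral>\<^sup>+\<omega>. g (U \<omega>) x \<partial>M) \<partial>lborel)"
proof -
  have fix_n: "(\<integral>\<^sup>+\<omega>. g (U \<omega>) (\<Sum>j=1..Suc n. hops \<omega> j) \<partial>M)
      = (\<integral>\<^sup>+\<omega>. \<integral>\<^sup>+u. g (U u) (\<Sum>j=1..Suc n. hops \<omega> j) \<partial>M \<partial>M)" for n
    by (rule nn_integral_U_hops[of "\<lambda>u y. g u (\<Sum>j=1..Suc n. y j)"]) measurable
  have "(\<integral>\<^sup>+\<omega>. g (U \<omega>) (interarrival K Y \<omega>) \<partial>M) = (\<integral>\<^sup>+\<omega>. g (U \<omega>) (\<Sum>j=1..K \<omega>. hops \<omega> j) \<partial>M)"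
    by (simp add: interarrival_def)
  also have "\<dots> = (\<Sum>n. ennreal (p * (1 - p) ^ n) * (\<integral>\<^sup>+\<omega>. g (U \<omega>) (\<Sum>j=1..Suc n. hops \<omega> j) \<partial>M))"
    by (rule nn_integral_mixture[of "\<lambda>k u y. g u (\<Sum>j=1..k. y j)"]) measurable
  also have "\<dots> = (\<Sum>n. ennreal (p * (1 - p) ^ n) * (\<integral>\<^sup>+\<omega>. \<integral>\<^sup>+u. g (U u) (\<Sum>j=1..Suc n. hops \<omega> j) \<partial>M \<partial>M))"
    unfolding fix_n ..
  also have "\<dots> = (\<integral>\<^sup>+\<omega>. \<integral>\<^sup>+u. g (U u) (\<Sum>j=1..K \<omega>. hops \<omega> j) \<partial>M \<partial>M)"
    by (rule nn_integral_mixture[of "\<lambda>k _ y. \<integral>\<^sup>+u. g (U u) (\<Sum>j=1..k. y j) \<partial>M", symmetric]) measurable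
  also have "\<dots> = (\<integral>\<^sup>+\<omega>. \<integral>\<^sup>+u. g (U u) (interarrival K Y \<omega>) \<partial>M \<partial>M)"
    by (simp add: interarrival_def)
  also have "\<dots> = (\<integral>\<^sup>+x. ennreal (exponential_density (p * lam) x) * (\<integral>\<^sup>+\<omega>. g (U \<omega>) x \<partial>M) \<partial>lborel)"
    by (rule nn_integral_interarrival) measurable
  finally show ?thesis .
qed

lemma interarrival_measurable [measurable]: "interarrival K Y \<in> borel_measurable M"
proof -
  have "(\<lambda>\<omega>. (\<lambda>k \<omega>. \<Sum>j=1..k. Y j \<omega>) (K \<omega>) \<omega>) \<in> borel_measurable M"
    by (rule measurable_compose_countable) (auto intro!: borel_measurable_sum)
  then show ?thesis
    by (simp add: interarrival_def[abs_def])
qed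

lemma waiting_time_measurable [measurable]: "waiting_time U K Y \<in> borel_measurable M"
  unfolding waiting_time_def[abs_def] by measurable

lemma system_time_measurable [measurable]: "system_time D U K Y \<in> borel_measurable M"
  unfolding system_time_def[abs_def] by measurable

section \<open>Stationarity and the excess of the system time\<close>

definition F :: "real \<Rightarrow> real" where
  "F = cdf (distr M borel (waiting_time U K Y))"

lemma F_eq: "F w = prob {\<omega> \<in> space M. waiting_time U K Y \<omega> \<le> w}"
  by (simp add: F_def cdf_def measure_distr vimage_def Int_def conj_commute)

lemma nn_integral_U_shift:
  assumes [measurable]: "f \<in> borel_measurable borel"
  shows "(\<integral>\<^sup>+\<omega>. f (U \<omega>) \<partial>M) = (\<integral>\<^sup>+\<omega>. f (waiting_time U K Y \<omega> + D) \<partial>M)"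
proof -
  have "(\<integral>\<^sup>+\<omega>. f (U \<omega>) \<partial>M) = (\<integral>\<^sup>+u. f u \<partial>distr M borel U)"
    by (simp add: nn_integral_distr)
  also have "\<dots> = (\<integral>\<^sup>+\<omega>. f (system_time D U K Y \<omega>) \<partial>M)"
    by (simp add: nn_integral_distr flip: steady_state)
  finally show ?thesis
    by (simp add: system_time_def)
qed

lemma nn_integral_waiting_le: "(\<integral>\<^sup>+\<omega>. indicator {..w} (waiting_time U K Y \<omega>) \<partial>M) = ennreal (F w)"
proof -
  have "(\<integral>\<^sup>+\<omega>. indicator {..w} (waiting_time U K Y \<omega>) \<partial>M)
    = (\<integral>\<^sup>+\<omega>. indicator {\<omega> \<in> space M. waiting_time U K Y \<omega> \<le> w} \<omega> \<partial>M)"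
    by (intro nn_integral_cong) (auto split: split_indicator)
  then show ?thesis
    by (simp add: F_eq emeasure_eq_measure)
qed

text \<open>For \<open>w \<ge> 0\<close> the waiting time is at most \<open>w\<close> iff
  \<open>U\<close> is at most \<open>w\<close> plus the interarrival time. The latter is exponential
  and independent of \<open>U\<close>, and by stationarity \<open>U\<close> has the law of a waiting
  time plus \<open>D\<close>.\<close>

sublocale md1: md1_lindley "p * lam" D F
proof
  interpret W: real_distribution "distr M borel (waiting_time U K Y)"
    by (rule real_distribution_distr) simp
  show "0 < p * lam" "0 < D" "p * lam * D < 1"
    using p_pos lam_pos D_pos load by simp_all
  show "mono F"
    unfolding F_def by (intro monoI W.cdf_nondecreasing)
  show "(F \<longlongrightarrow> 1) at_top"
    unfolding F_def by (rule W.cdf_lim_at_top_prob)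
  show "F x = 0" if "x < 0" for x
    using that by (simp add: F_eq waiting_time_def)
  show "ennreal (F w) = (\<integral>\<^sup>+x. ennreal (exponential_density (p * lam) x * F (w + x - D)) \<partial>lborel)"
    if "0 \<le> w" for w
  proof -
    have shift: "(\<integral>\<^sup>+\<omega>. indicator {..w + x} (U \<omega>) \<partial>M) = ennreal (F (w + x - D))" for x
      unfolding nn_integral_waiting_le[symmetric]
      by (subst nn_integral_U_shift) (auto intro!: nn_integral_cong split: split_indicator)
    have "ennreal (F w) = (\<integral>\<^sup>+\<omega>. indicator {..w + interarrival K Y \<omega>} (U \<omega>) \<partial>M)"
      unfolding nn_integral_waiting_le[symmetric]
      using that by (intro nn_integral_cong) (auto simp: waiting_time_def split: split_indicator)
    also have "\<dots> = (\<integral>\<^sup>+x. ennreal (exponential_density (p * lam) x) * (\<integral>\<^sup>+\<omega>. indicator {..w + x} (U \<omega>) \<partial>M) \<partial>lborel)"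
    proof (rule nn_integral_U_interarrival[of "\<lambda>u x. indicator {..w + x} u"])
      show "(\<lambda>(u, x). indicator {..w + x} u :: ennreal) \<in> borel_measurable (borel \<Otimes>\<^sub>M borel)"
        unfolding indicator_def atMost_iff by measurable
    qed
    finally show ?thesis
      unfolding shift using p_pos lam_pos by (simp add: ennreal_mult' exponential_density_nonneg)
  qed
qed

text \<open>Layer-cake formula: \<open>max 0 (W + D - x)\<close> is the length of
  \<open>{x - D..<W}\<close>, so Tonelli's theorem turns its mean into the tail integral of
  \<open>survival\<close>.\<close>

lemma nn_integral_excess_U:
  "(\<integral>\<^sup>+\<omega>. ennreal (max 0 (U \<omega> - (\<Sum>j=1..k. y j))) \<partial>M) = ennreal (wait_kernel (p * lam) D k y)"
proof -
  interpret LM: pair_sigma_finite lborel M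
    by (intro pair_sigma_finite.intro sigma_finite_measure_axioms lborel.sigma_finite_measure_axioms)
  let ?x = "\<Sum>j=1..k. y j" and ?W = "waiting_time U K Y"
  have "(\<integral>\<^sup>+\<omega>. ennreal (max 0 (U \<omega> - ?x)) \<partial>M) = (\<integral>\<^sup>+\<omega>. ennreal (max 0 (?W \<omega> + D - ?x)) \<partial>M)"
    by (rule nn_integral_U_shift) measurable
  also have "\<dots> = (\<integral>\<^sup>+\<omega>. \<integral>\<^sup>+t. indicator {?x - D..} t * indicator {t<..} (?W \<omega>) \<partial>lborel \<partial>M)"
  proof (intro nn_integral_cong)
    fix \<omega>
    have "(\<integral>\<^sup>+t. indicator {?x - D..} t * indicator {t<..} (?W \<omega>) \<partial>lborel)
      = (\<integral>\<^sup>+t. indicator {?x - D..<?W \<omega>} t \<partial>lborel)"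
      by (intro nn_integral_cong) (auto split: split_indicator)
    also have "\<dots> = ennreal (max 0 (?W \<omega> + D - ?x))"
      by (cases "?x - D \<le> ?W \<omega>") (auto simp: max_def algebra_simps)
    finally show "ennreal (max 0 (?W \<omega> + D - ?x))
      = (\<integral>\<^sup>+t. indicator {?x - D..} t * indicator {t<..} (?W \<omega>) \<partial>lborel)" ..
  qed
  also have "\<dots> = (\<integral>\<^sup>+t. \<integral>\<^sup>+\<omega>. indicator {?x - D..} t * indicator {t<..} (?W \<omega>) \<partial>M \<partial>lborel)"
  proof (rule LM.Fubini')
    show "(\<lambda>(t, \<omega>). indicator {?x - D..} t * indicator {t<..} (?W \<omega>) :: ennreal) \<in> borel_measurable (lborel \<Otimes>\<^sub>M M)"
      unfolding indicator_def greaterThan_iff by measurable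
  qed
  also have "\<dots> = (\<integral>\<^sup>+t. md1.survival t * indicator {?x - D..} t \<partial>lborel)"
  proof (intro nn_integral_cong)
    fix t
    have "(\<integral>\<^sup>+\<omega>. indicator {t<..} (?W \<omega>) \<partial>M) = (\<integral>\<^sup>+\<omega>. indicator {\<omega> \<in> space M. \<not> ?W \<omega> \<le> t} \<omega> \<partial>M)"
      by (intro nn_integral_cong) (auto split: split_indicator)
    also have "\<dots> = md1.survival t"
      by (simp add: emeasure_eq_measure md1.survival_def F_eq prob_neg)
    finally show "(\<integral>\<^sup>+\<omega>. indicator {?x - D..} t * indicator {t<..} (?W \<omega>) \<partial>M) = md1.survival t * indicator {?x - D..} t"
      by (subst nn_integral_cmult) (simp_all add: mult.commute)
  qed
  also have "\<dots> = ennreal (wait_kernel (p * lam) D k y)"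
    by (rule md1.tail_eq_wait_kernel) simp
  finally show ?thesis .
qed

text \<open>Independence identifies the law of the first \<open>k\<close> hops with a product of
  exponential laws, and \<open>PiM_density\<close> gives its density; \<open>1 \<le> k\<close> keeps
  the index set nonempty.\<close>

lemma nn_integral_hops_block:
  assumes "1 \<le> k" and \<phi>: "\<phi> \<in> borel_measurable (\<Pi>\<^sub>M j\<in>{1..k}. lborel)"
  shows "(\<integral>\<^sup>+\<omega>. \<phi> (\<lambda>j\<in>{1..k}. Y j \<omega>) \<partial>M)
    = (\<integral>\<^sup>+y. (\<Prod>j\<in>{1..k}. ennreal (exponential_density lam (y j))) * \<phi> y \<partial>(\<Pi>\<^sub>M j\<in>{1..k}. lborel))"
proof -
  have sets: "sets (\<Pi>\<^sub>M j\<in>{1..k}. borel) = sets (\<Pi>\<^sub>M j\<in>{1..k}. (lborel :: real measure))"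
    by (intro sets_PiM_cong) auto
  have Y: "distr M borel (Y j) = density lborel (\<lambda>x. ennreal (exponential_density lam x))" if "j \<in> {1..k}" for j
  proof -
    have "distr M borel (Y j) = distr M lborel (Y j)"
      by (rule distr_cong) auto
    then show ?thesis
      using distributed_distr_eq_density[OF hops_exponential[of j]] that by simp
  qed
  have "distr M (\<Pi>\<^sub>M j\<in>{1..k}. borel) (\<lambda>\<omega>. \<lambda>j\<in>{1..k}. Y j \<omega>) = (\<Pi>\<^sub>M j\<in>{1..k}. distr M borel (Y j))"
    using assms(1) indep_vars_subset[OF hops_indep, of "{1..k}"]
    by (subst indep_vars_iff_distr_eq_PiM'[symmetric]) auto
  also have "\<dots> = (\<Pi>\<^sub>M j\<in>{1..k}. density lborel (\<lambda>x. ennreal (exponential_density lam x)))"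
    by (intro PiM_cong refl Y)
  also have "\<dots> = density (\<Pi>\<^sub>M j\<in>{1..k}. lborel) (\<lambda>y. \<Prod>j\<in>{1..k}. ennreal (exponential_density lam (y j)))"
  proof (rule PiM_density)
    show "product_sigma_finite (\<lambda>_::nat. lborel :: real measure)"
      by standard
    interpret hop: prob_space "density lborel (\<lambda>x. ennreal (exponential_density lam x))"
      by (rule prob_space_exponential_density[OF lam_pos])
    show "product_sigma_finite (\<lambda>_::nat. density lborel (\<lambda>x. ennreal (exponential_density lam x)))"
      by standard
  qed measurable
  finally have distr: "distr M (\<Pi>\<^sub>M j\<in>{1..k}. borel) (\<lambda>\<omega>. \<lambda>j\<in>{1..k}. Y j \<omega>)
    = density (\<Pi>\<^sub>M j\<in>{1..k}. lborel) (\<lambda>y. \<Prod>j\<in>{1..k}. ennreal (exponential_density lam (y j)))" .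
  have "(\<integral>\<^sup>+\<omega>. \<phi> (\<lambda>j\<in>{1..k}. Y j \<omega>) \<partial>M)
    = integral\<^sup>N (distr M (\<Pi>\<^sub>M j\<in>{1..k}. borel) (\<lambda>\<omega>. \<lambda>j\<in>{1..k}. Y j \<omega>)) \<phi>"
    by (subst nn_integral_distr) (use \<phi> measurable_cong_sets[OF sets refl] in \<open>auto intro!: measurable_restrict\<close>)
  also have "\<dots> = (\<integral>\<^sup>+y. (\<Prod>j\<in>{1..k}. ennreal (exponential_density lam (y j))) * \<phi> y \<partial>(\<Pi>\<^sub>M j\<in>{1..k}. lborel))"
    unfolding distr by (rule nn_integral_density) (use \<phi> in measurable)
  finally show ?thesis .
qed

section \<open>Moments of the hops\<close>

lemma AE_hops_nonneg: "AE \<omega> in M. \<forall>j\<ge>1. 0 \<le> Y j \<omega>"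
proof -
  have "AE \<omega> in M. 0 \<le> Y j \<omega>" if "1 \<le> j" for j
    by (subst distributed_AE2[OF hops_exponential[OF that]]) (auto simp: erlang_density_def)
  then have "AE \<omega> in M. 1 \<le> j \<longrightarrow> 0 \<le> Y j \<omega>" for j
    by (cases "1 \<le> j") simp_all
  then show ?thesis
    by (simp only: AE_all_countable) blast
qed

lemma has_bochner_integral_hop_power:
  "1 \<le> j \<Longrightarrow> has_bochner_integral M (\<lambda>\<omega>. Y j \<omega> ^ i) (fact i / lam ^ i)"
  using has_bochner_integral_erlang_ith_moment[OF lam_pos hops_exponential, of j i] by simp

text \<open>Distinct hops are independent, so the mean is \<open>1 / lam\<close> times
  \<open>2 / lam^2\<close>. The family \<open>?X\<close> applies the identity at \<open>j\<close>
  and the square at \<open>l\<close>.\<close>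

lemma has_bochner_integral_hop_square_hop:
  assumes "1 \<le> l" "l < j"
  shows "has_bochner_integral M (\<lambda>\<omega>. Y j \<omega> * (Y l \<omega>)\<^sup>2) (2 / lam ^ 3)"
proof -
  let ?X = "\<lambda>i \<omega>. if i = j then Y i \<omega> else (Y i \<omega>)\<^sup>2"
  have "indep_vars (\<lambda>_. borel) (\<lambda>i \<omega>. (if i = j then (\<lambda>x. x) else (\<lambda>x. x\<^sup>2)) (Y i \<omega>)) {l, j}"
    by (rule indep_vars_compose2[OF indep_vars_subset[OF hops_indep]]) (use assms in auto)
  then have ind: "indep_vars (\<lambda>_. borel) ?X {l, j}"
    by (simp add: if_distrib[of "\<lambda>f. f _"])
  have "has_bochner_integral M (?X l) (2 / lam\<^sup>2)" "has_bochner_integral M (?X j) (1 / lam)"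
    using has_bochner_integral_hop_power[of l 2] has_bochner_integral_hop_power[of j 1] assms by simp_all
  then have intX: "integrable M (?X l)" "integrable M (?X j)"
    and I: "integral\<^sup>L M (?X l) = 2 / lam\<^sup>2" "integral\<^sup>L M (?X j) = 1 / lam"
    unfolding has_bochner_integral_iff by blast+
  have int: "integrable M (?X i)" if "i \<in> {l, j}" for i
    using intX that by blast
  have "has_bochner_integral M (\<lambda>\<omega>. \<Prod>i\<in>{l, j}. ?X i \<omega>) (\<Prod>i\<in>{l, j}. integral\<^sup>L M (?X i))"
    unfolding has_bochner_integral_iff
    using indep_vars_lebesgue_integral[OF _ ind int] indep_vars_integrable[OF _ ind int] by simp
  moreover have "(\<Prod>i\<in>{l, j}. integral\<^sup>L M (?X i)) = 2 / lam ^ 3"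
  proof -
    have "(\<Prod>i\<in>{l, j}. integral\<^sup>L M (?X i)) = integral\<^sup>L M (?X l) * integral\<^sup>L M (?X j)"
      using assms by (subst prod.insert) auto
    then show ?thesis
      unfolding I by (simp add: power2_eq_square power3_eq_cube)
  qed
  moreover have "(\<lambda>\<omega>. \<Prod>i\<in>{l, j}. ?X i \<omega>) = (\<lambda>\<omega>. Y j \<omega> * (Y l \<omega>)\<^sup>2)"
    using assms by (auto simp: mult.commute)
  ultimately show ?thesis
    by simp
qed

subsection \<open>The expected cost of a cycle\<close>

text \<open>By \<open>nn_integral_excess_U\<close> the kernel is the mean of
  \<open>max 0 (U - x)\<close> at total hop length \<open>x\<close>.\<close>

abbreviation excess_mean :: "nat \<Rightarrow> (nat \<Rightarrow> real) \<Rightarrow> real" where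
  "excess_mean \<equiv> wait_kernel (p * lam) D"

definition squares :: "real \<Rightarrow> nat \<Rightarrow> (nat \<Rightarrow> real) \<Rightarrow> real" where
  "squares v k y = (\<Sum>j=1..k. v\<^sup>2 * (y j)\<^sup>2)"

lemma squares_nonneg: "0 \<le> squares v k y"
  unfolding squares_def by (intro sum_nonneg) simp

lemma squares_cong: "(\<And>j. j \<in> {1..k} \<Longrightarrow> y j = z j) \<Longrightarrow> squares v k y = squares v k z"
  by (simp add: squares_def)

lemma has_bochner_integral_squares:
  "has_bochner_integral M (\<lambda>\<omega>. squares v k (\<lambda>j. Y j \<omega>)) (2 * real k * v\<^sup>2 / lam\<^sup>2)"
proof -
  have "has_bochner_integral M (\<lambda>\<omega>. \<Sum>j=1..k. v\<^sup>2 * (Y j \<omega>)\<^sup>2) (\<Sum>j=1..k. v\<^sup>2 * (fact 2 / lam\<^sup>2))"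
    by (intro has_bochner_integral_sum has_bochner_integral_mult_right has_bochner_integral_hop_power) auto
  then show ?thesis
    by (simp add: squares_def mult_ac)
qed

text \<open>As an integral over \<open>M\<close> with the hops as parameters, the kernel is seen to
  be measurable without inspecting the density inside it.\<close>

lemma excess_mean_eq: "excess_mean k y = enn2real (\<integral>\<^sup>+\<omega>. ennreal (max 0 (U \<omega> - (\<Sum>j=1..k. y j))) \<partial>M)"
  by (simp only: nn_integral_excess_U) (simp add: md1.tail_eq_wait_kernel(2)[OF refl])

lemma excess_mean_nonneg: "0 \<le> excess_mean k y"
  by (rule md1.tail_eq_wait_kernel(2)) simp

lemma excess_mean_measurable [measurable]: "excess_mean k \<in> borel_measurable (\<Pi>\<^sub>M j\<in>{1..k}. lborel)"
  unfolding excess_mean_eq[abs_def] by measurable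

text \<open>The bound is the mean of \<open>max 0 U\<close>, the excess over an empty sum; it
  dominates the kernel in all integrability arguments below.\<close>

lemma excess_mean_le:
  assumes "0 \<le> (\<Sum>j=1..k. y j)"
  shows "excess_mean k y \<le> excess_mean 0 (\<lambda>_. 0)"
proof -
  have "ennreal (excess_mean k y) \<le> ennreal (excess_mean 0 (\<lambda>_. 0))"
    unfolding nn_integral_excess_U[symmetric]
    using assms by (intro nn_integral_mono ennreal_leI) auto
  then show ?thesis
    by (simp add: excess_mean_nonneg)
qed

text \<open>The exponential densities vanish at negative arguments, which is why the integral runs
  over the nonnegative orthant.\<close>

lemma hop_density:
  assumes "y \<in> space (\<Pi>\<^sub>M j\<in>{1..k}. (lborel :: real measure))"
  shows "(\<Prod>j\<in>{1..k}. ennreal (exponential_density lam (y j))) * ennreal (squares v k y * excess_mean k y)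
    = ennreal (indicator (\<Pi>\<^sub>E j\<in>{1..k}. {0..}) y *\<^sub>R hop_integrand v lam (p * lam) D k y)"
proof (cases "y \<in> (\<Pi>\<^sub>E j\<in>{1..k}. {0..})")
  case True
  have "(\<Prod>j\<in>{1..k}. exponential_density lam (y j)) = (\<Prod>j\<in>{1..k}. lam * exp (- lam * y j))"
  proof (rule prod.cong)
    fix j assume "j \<in> {1..k}"
    then have "0 \<le> y j"
      using True by (auto simp: PiE_iff)
    then show "exponential_density lam (y j) = lam * exp (- lam * y j)"
      by (simp add: exponential_density_def mult.commute)
  qed simp
  also have "\<dots> = lam ^ k * exp (- lam * (\<Sum>j=1..k. y j))"
    by (simp add: prod.distrib sum_distrib_left exp_sum flip: sum_negf)
  finally have "(\<Prod>j\<in>{1..k}. ennreal (exponential_density lam (y j)))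
      = ennreal (lam ^ k * exp (- lam * (\<Sum>j=1..k. y j)))"
    using lam_pos by (subst prod_ennreal) (auto simp: exponential_density_nonneg)
  moreover have "hop_integrand v lam (p * lam) D k y
      = lam ^ k * exp (- lam * (\<Sum>j=1..k. y j)) * (squares v k y * excess_mean k y)"
    by (simp add: hop_integrand_def squares_def mult_ac flip: sum_distrib_left)
  ultimately show ?thesis
    using True lam_pos by (simp add: ennreal_mult')
next
  case False
  \<comment> \<open>As \<open>y\<close> is extensional, it can leave the orthant only through a
    negative coordinate.\<close>
  with assms obtain j where "j \<in> {1..k}" "y j < 0"
    by (auto simp: space_PiM PiE_iff not_le)
  then have "(\<Prod>j\<in>{1..k}. ennreal (exponential_density lam (y j))) = 0"
    by (intro prod_zero) (auto simp: exponential_density_def intro!: bexI[of _ j])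
  then show ?thesis
    using False by simp
qed

text \<open>One chain of nonnegative integrals yields all four claims: integrating out
  \<open>U\<close> replaces the waiting time by \<open>excess_mean\<close>, and the law of the hops
  turns the result into the integral of \<open>hop_integrand\<close>. Bounding
  \<open>excess_mean\<close> by its value at 0 makes everything finite.\<close>

lemma hop_excess:
  assumes "1 \<le> k"
  shows set_integrable_hop_integrand:
      "set_integrable (\<Pi>\<^sub>M j\<in>{1..k}. lborel) (\<Pi>\<^sub>E j\<in>{1..k}. {0..}) (hop_integrand v lam (p * lam) D k)"
    and hop_integral_nonneg: "0 \<le> hop_integral v lam (p * lam) D k"
    and hop_integral_le:
      "hop_integral v lam (p * lam) D k \<le> excess_mean 0 (\<lambda>_. 0) * (2 * real k * v\<^sup>2 / lam\<^sup>2)"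
    and has_bochner_integral_excess:
      "has_bochner_integral M
        (\<lambda>\<omega>. squares v k (\<lambda>j. Y j \<omega>) * max 0 (U \<omega> - (\<Sum>j=1..k. Y j \<omega>)))
        (hop_integral v lam (p * lam) D k)"
proof -
  let ?P = "\<Pi>\<^sub>M j\<in>{1..k}. (lborel :: real measure)" and ?S = "\<Pi>\<^sub>E j\<in>{1..k}. {0::real..}"
  let ?H = "\<lambda>\<omega>. squares v k (\<lambda>j. Y j \<omega>)"
  let ?h = "\<lambda>y. indicator ?S y *\<^sub>R hop_integrand v lam (p * lam) D k y"
  have [measurable]: "?S \<in> sets ?P"
    by (intro sets_PiM_I_finite) auto
  have [measurable]: "squares v k \<in> borel_measurable ?P"
    unfolding squares_def[abs_def] by measurable
  have h_meas: "?h \<in> borel_measurable ?P"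
    unfolding hop_integrand_def[abs_def] by measurable
  have h_nonneg: "0 \<le> ?h y" for y
  proof (cases "y \<in> ?S")
    case True
    then show ?thesis
      using lam_pos excess_mean_nonneg by (auto simp: hop_integrand_def intro!: mult_nonneg_nonneg sum_nonneg)
  qed simp
  have "(\<integral>\<^sup>+\<omega>. ennreal (?H \<omega> * max 0 (U \<omega> - (\<Sum>j=1..k. Y j \<omega>))) \<partial>M)
    = (\<integral>\<^sup>+\<omega>. ennreal (squares v k (hops \<omega>) * max 0 (U \<omega> - (\<Sum>j=1..k. hops \<omega> j))) \<partial>M)"
    by (intro nn_integral_cong) (simp add: squares_def)
  also have "\<dots> = (\<integral>\<^sup>+\<omega>. \<integral>\<^sup>+u. ennreal (squares v k (hops \<omega>) * max 0 (U u - (\<Sum>j=1..k. hops \<omega> j))) \<partial>M \<partial>M)"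
    by (rule nn_integral_U_hops[of "\<lambda>u y. ennreal (squares v k y * max 0 (u - (\<Sum>j=1..k. y j)))"])
      (unfold squares_def, measurable)
  also have "\<dots> = (\<integral>\<^sup>+\<omega>. ennreal (squares v k (hops \<omega>) * excess_mean k (hops \<omega>)) \<partial>M)"
  proof (intro nn_integral_cong)
    fix \<omega>
    have "(\<integral>\<^sup>+u. ennreal (squares v k (hops \<omega>) * max 0 (U u - (\<Sum>j=1..k. hops \<omega> j))) \<partial>M)
      = ennreal (squares v k (hops \<omega>)) * (\<integral>\<^sup>+u. ennreal (max 0 (U u - (\<Sum>j=1..k. hops \<omega> j))) \<partial>M)"
      unfolding ennreal_mult'[OF squares_nonneg] by (rule nn_integral_cmult) measurable
    then show "(\<integral>\<^sup>+u. ennreal (squares v k (hops \<omega>) * max 0 (U u - (\<Sum>j=1..k. hops \<omega> j))) \<partial>M)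
      = ennreal (squares v k (hops \<omega>) * excess_mean k (hops \<omega>))"
      unfolding ennreal_mult'[OF squares_nonneg] nn_integral_excess_U .
  qed
  finally have excess: "(\<integral>\<^sup>+\<omega>. ennreal (?H \<omega> * max 0 (U \<omega> - (\<Sum>j=1..k. Y j \<omega>))) \<partial>M)
    = (\<integral>\<^sup>+\<omega>. ennreal (squares v k (hops \<omega>) * excess_mean k (hops \<omega>)) \<partial>M)" .
  have "(\<integral>\<^sup>+\<omega>. ennreal (squares v k (hops \<omega>) * excess_mean k (hops \<omega>)) \<partial>M)
    = (\<integral>\<^sup>+\<omega>. ennreal (squares v k (\<lambda>j\<in>{1..k}. Y j \<omega>) * excess_mean k (\<lambda>j\<in>{1..k}. Y j \<omega>)) \<partial>M)"
  proof (intro nn_integral_cong)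
    fix \<omega>
    have "squares v k (hops \<omega>) = squares v k (\<lambda>j\<in>{1..k}. Y j \<omega>)"
      by (intro squares_cong) simp
    moreover have "excess_mean k (hops \<omega>) = excess_mean k (\<lambda>j\<in>{1..k}. Y j \<omega>)"
      by (intro wait_kernel_cong sum.cong) simp_all
    ultimately show "ennreal (squares v k (hops \<omega>) * excess_mean k (hops \<omega>))
        = ennreal (squares v k (\<lambda>j\<in>{1..k}. Y j \<omega>) * excess_mean k (\<lambda>j\<in>{1..k}. Y j \<omega>))"
      by simp
  qed
  also have "\<dots> = (\<integral>\<^sup>+y. (\<Prod>j\<in>{1..k}. ennreal (exponential_density lam (y j)))
      * ennreal (squares v k y * excess_mean k y) \<partial>?P)"
    by (rule nn_integral_hops_block[OF assms]) measurable
  also have "\<dots> = (\<integral>\<^sup>+y. ennreal (?h y) \<partial>?P)"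
    by (intro nn_integral_cong hop_density)
  finally have mean_form: "(\<integral>\<^sup>+y. ennreal (?h y) \<partial>?P)
    = (\<integral>\<^sup>+\<omega>. ennreal (squares v k (hops \<omega>) * excess_mean k (hops \<omega>)) \<partial>M)" ..
  have "(\<integral>\<^sup>+y. ennreal (?h y) \<partial>?P) \<le> (\<integral>\<^sup>+\<omega>. ennreal (excess_mean 0 (\<lambda>_. 0) * ?H \<omega>) \<partial>M)"
    unfolding mean_form
  proof (rule nn_integral_mono_AE)
    show "AE \<omega> in M. ennreal (squares v k (hops \<omega>) * excess_mean k (hops \<omega>)) \<le> ennreal (excess_mean 0 (\<lambda>_. 0) * ?H \<omega>)"
      using AE_hops_nonneg
    proof eventually_elim
      case (elim \<omega>)
      have "excess_mean k (hops \<omega>) \<le> excess_mean 0 (\<lambda>_. 0)"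
        by (rule excess_mean_le) (use elim in \<open>auto intro: sum_nonneg\<close>)
      moreover have "squares v k (hops \<omega>) = ?H \<omega>"
        by (intro squares_cong) simp
      ultimately show ?case
        using squares_nonneg[of v k "\<lambda>j. Y j \<omega>"]
        by (intro ennreal_leI) (simp add: mult.commute mult_left_mono)
    qed
  qed
  also have "\<dots> = ennreal (excess_mean 0 (\<lambda>_. 0) * (2 * real k * v\<^sup>2 / lam\<^sup>2))"
    using has_bochner_integral_mult_right[OF has_bochner_integral_squares[of v k], of "excess_mean 0 (\<lambda>_. 0)"]
    by (simp add: has_bochner_integral_iff nn_integral_eq_integral squares_nonneg excess_mean_nonneg)
  finally have le: "(\<integral>\<^sup>+y. ennreal (?h y) \<partial>?P) \<le> ennreal (excess_mean 0 (\<lambda>_. 0) * (2 * real k * v\<^sup>2 / lam\<^sup>2))" .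
  have int: "integrable ?P ?h"
    by (rule integrableI_nonneg) (use h_meas h_nonneg le in \<open>auto simp: order_le_less_trans\<close>)
  then show "set_integrable ?P ?S (hop_integrand v lam (p * lam) D k)"
    by (simp add: set_integrable_def)
  have hop: "(\<integral>\<^sup>+y. ennreal (?h y) \<partial>?P) = ennreal (hop_integral v lam (p * lam) D k)"
    unfolding hop_integral_def set_lebesgue_integral_def
    by (rule nn_integral_eq_integral[OF int]) (use h_nonneg in auto)
  show nonneg: "0 \<le> hop_integral v lam (p * lam) D k"
    unfolding hop_integral_def set_lebesgue_integral_def
    by (rule integral_nonneg_AE) (use h_nonneg in auto)
  have "0 \<le> excess_mean 0 (\<lambda>_. 0) * (2 * real k * v\<^sup>2 / lam\<^sup>2)"
    by (simp add: excess_mean_nonneg)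
  then show "hop_integral v lam (p * lam) D k \<le> excess_mean 0 (\<lambda>_. 0) * (2 * real k * v\<^sup>2 / lam\<^sup>2)"
    using le unfolding hop by (simp add: ennreal_le_iff)
  show "has_bochner_integral M (\<lambda>\<omega>. ?H \<omega> * max 0 (U \<omega> - (\<Sum>j=1..k. Y j \<omega>))) (hop_integral v lam (p * lam) D k)"
  proof (rule has_bochner_integral_nn_integral)
    show "(\<integral>\<^sup>+\<omega>. ennreal (?H \<omega> * max 0 (U \<omega> - (\<Sum>j=1..k. Y j \<omega>))) \<partial>M) = ennreal (hop_integral v lam (p * lam) D k)"
      using excess mean_form hop by simp
    show "(\<lambda>\<omega>. ?H \<omega> * max 0 (U \<omega> - (\<Sum>j=1..k. Y j \<omega>))) \<in> borel_measurable M"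
      unfolding squares_def by (auto intro!: borel_measurable_times borel_measurable_sum borel_measurable_max borel_measurable_diff borel_measurable_power)
  qed (use nonneg squares_nonneg in auto)
qed

text \<open>The cost of a cycle with \<open>K\<close>, \<open>U\<close> and the hops as explicit
  arguments, the form in which the mixture over \<open>K\<close> applies.\<close>

definition cost :: "real \<Rightarrow> nat \<Rightarrow> real \<Rightarrow> (nat \<Rightarrow> real) \<Rightarrow> real" where
  "cost v k u y = (\<Sum>j=1..k. v\<^sup>2 / 3 * y j ^ 3) + (\<Sum>j=1..k. y j * (\<Sum>l=1..<j. v\<^sup>2 * (y l)\<^sup>2))
    + squares v k y * (max 0 (u - (\<Sum>j=1..k. y j)) + D)"

text \<open>The summands stem, in order, from the cubes, from the \<open>k * (k - 1) / 2\<close>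
  pairs \<open>l < j\<close>, from the service time and from the waiting time.\<close>

definition cost_mean :: "real \<Rightarrow> nat \<Rightarrow> real" where
  "cost_mean v k = 2 * v\<^sup>2 / lam ^ 3 * real k + v\<^sup>2 / lam ^ 3 * (real k * (real k - 1))
    + 2 * v\<^sup>2 * D / lam\<^sup>2 * real k + hop_integral v lam (p * lam) D k"

lemma cost_cong: "(\<And>j. j \<in> {1..k} \<Longrightarrow> y j = z j) \<Longrightarrow> cost v k u y = cost v k u z"
  unfolding cost_def squares_def by (intro arg_cong2[where f="(+)"] arg_cong2[where f="(*)"] sum.cong arg_cong2[where f=max] arg_cong2[where f="(-)"]) auto

lemma cycle_cost_eq: "cycle_cost v D U K Y \<omega> = cost v (K \<omega>) (U \<omega>) (hops \<omega>)"
proof -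
  have "cycle_cost v D U K Y \<omega> = cost v (K \<omega>) (U \<omega>) (\<lambda>j. Y j \<omega>)"
    by (simp add: cycle_cost_def cost_def hop_squares_def system_time_def waiting_time_def
        interarrival_def squares_def)
  also have "\<dots> = cost v (K \<omega>) (U \<omega>) (hops \<omega>)"
    by (rule cost_cong) simp
  finally show ?thesis .
qed

lemma has_bochner_integral_cost:
  assumes "1 \<le> k"
  shows "has_bochner_integral M (\<lambda>\<omega>. cost v k (U \<omega>) (hops \<omega>)) (cost_mean v k)"
proof -
  let ?Y = "\<lambda>\<omega> j. Y j \<omega>"
  have G1: "has_bochner_integral M (\<lambda>\<omega>. \<Sum>j=1..k. v\<^sup>2 / 3 * Y j \<omega> ^ 3) (\<Sum>j=1..k. v\<^sup>2 / 3 * (fact 3 / lam ^ 3))"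
    by (intro has_bochner_integral_sum has_bochner_integral_mult_right has_bochner_integral_hop_power) auto
  have "has_bochner_integral M (\<lambda>\<omega>. \<Sum>j=1..k. \<Sum>l=1..<j. v\<^sup>2 * (Y j \<omega> * (Y l \<omega>)\<^sup>2))
      (\<Sum>j=1..k. \<Sum>l=1..<j. v\<^sup>2 * (2 / lam ^ 3))"
    by (intro has_bochner_integral_sum has_bochner_integral_mult_right has_bochner_integral_hop_square_hop) auto
  then have G2: "has_bochner_integral M (\<lambda>\<omega>. \<Sum>j=1..k. Y j \<omega> * (\<Sum>l=1..<j. v\<^sup>2 * (Y l \<omega>)\<^sup>2))
      (\<Sum>j=1..k. \<Sum>l=1..<j. v\<^sup>2 * (2 / lam ^ 3))"
    by (simp only: sum_distrib_left mult.left_commute)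
  have "has_bochner_integral M
      (\<lambda>\<omega>. ((\<Sum>j=1..k. v\<^sup>2 / 3 * Y j \<omega> ^ 3) + (\<Sum>j=1..k. Y j \<omega> * (\<Sum>l=1..<j. v\<^sup>2 * (Y l \<omega>)\<^sup>2)))
        + (squares v k (?Y \<omega>) * max 0 (U \<omega> - (\<Sum>j=1..k. Y j \<omega>)) + squares v k (?Y \<omega>) * D))
      (((\<Sum>j=1..k. v\<^sup>2 / 3 * (fact 3 / lam ^ 3)) + (\<Sum>j=1..k. \<Sum>l=1..<j. v\<^sup>2 * (2 / lam ^ 3)))
        + (hop_integral v lam (p * lam) D k + 2 * real k * v\<^sup>2 / lam\<^sup>2 * D))"
    by (intro has_bochner_integral_add G1 G2 has_bochner_integral_excess[OF assms]
        has_bochner_integral_mult_left has_bochner_integral_squares)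
  moreover have "(\<Sum>j=1..k. \<Sum>l=1..<j. v\<^sup>2 * (2 / lam ^ 3)) = v\<^sup>2 / lam ^ 3 * (real k * (real k - 1))"
  proof -
    have "(\<Sum>j=1..k. \<Sum>l=1..<j. v\<^sup>2 * (2 / lam ^ 3)) = v\<^sup>2 / lam ^ 3 * (2 * (\<Sum>j=1..k. real j - 1))"
      unfolding sum_distrib_left by (intro sum.cong) (auto simp: of_nat_diff field_simps)
    also have "2 * (\<Sum>j=1..k. real j - 1) = real k * (real k - 1)"
      by (induction k) (auto simp: algebra_simps)
    finally show ?thesis .
  qed
  moreover have "cost v k (U \<omega>) (hops \<omega>) = ((\<Sum>j=1..k. v\<^sup>2 / 3 * Y j \<omega> ^ 3) + (\<Sum>j=1..k. Y j \<omega> * (\<Sum>l=1..<j. v\<^sup>2 * (Y l \<omega>)\<^sup>2)))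
        + (squares v k (?Y \<omega>) * max 0 (U \<omega> - (\<Sum>j=1..k. Y j \<omega>)) + squares v k (?Y \<omega>) * D)" for \<omega>
  proof -
    have "cost v k (U \<omega>) (hops \<omega>) = cost v k (U \<omega>) (?Y \<omega>)"
      by (rule cost_cong) simp
    then show ?thesis
      by (simp only: cost_def distrib_left)
  qed
  moreover have "cost_mean v k = ((\<Sum>j=1..k. v\<^sup>2 / 3 * (fact 3 / lam ^ 3)) + v\<^sup>2 / lam ^ 3 * (real k * (real k - 1)))
        + (hop_integral v lam (p * lam) D k + 2 * real k * v\<^sup>2 / lam\<^sup>2 * D)"
    by (simp add: cost_mean_def fact_numeral field_simps)
  ultimately show ?thesis
    by (simp only:)
qed

text \<open>One null set serves all \<open>k\<close>, so that \<open>k\<close> may be set to the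
  random value of \<open>K\<close>.\<close>

lemma AE_cost_nonneg: "AE \<omega> in M. \<forall>k. 0 \<le> cost v k (U \<omega>) (hops \<omega>)"
  using AE_hops_nonneg
proof eventually_elim
  case (elim \<omega>)
  show ?case
    unfolding cost_def
    by (intro allI add_nonneg_nonneg mult_nonneg_nonneg sum_nonneg squares_nonneg)
      (use elim D_pos in auto)
qed

lemma cost_mean_nonneg:
  assumes "1 \<le> k"
  shows "0 \<le> cost_mean v k"
proof -
  have "0 \<le> (\<integral>\<omega>. cost v k (U \<omega>) (hops \<omega>) \<partial>M)"
    using AE_cost_nonneg[of v] by (intro integral_nonneg_AE) (simp add: AE_all_countable)
  then show ?thesis
    using has_bochner_integral_cost[OF assms] by (simp add: has_bochner_integral_iff)
qed

lemma cost_measurable [measurable]: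
  "case_prod (cost v k) \<in> borel_measurable (borel \<Otimes>\<^sub>M hop_space)"
proof -
  have [measurable]: "(\<lambda>y. \<Sum>l=1..<j. v\<^sup>2 * (y l)\<^sup>2) \<in> borel_measurable hop_space" for j
    by measurable
  show ?thesis
    unfolding cost_def squares_def by measurable
qed

section \<open>Summation over the number of hops\<close>

lemma summable_hop_integral:
  "summable (\<lambda>n. p * (1 - p) ^ n * hop_integral v lam (p * lam) D (Suc n))"
proof (rule summable_comparison_test')
  \<comment> \<open>\<open>hop_integral\<close> grows at most linearly in the number of hops, with
    slope \<open>?C\<close>, so the derivative of the geometric series dominates.\<close>
  let ?C = "excess_mean 0 (\<lambda>_. 0) * (2 * v\<^sup>2 / lam\<^sup>2)"
  have "norm (1 - p) < 1"
    using p_pos p_le_1 by simp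
  from sums_mult[OF geometric_deriv_sums[OF this], of "p * ?C"]
  show "summable (\<lambda>n. p * ?C * (real (Suc n) * (1 - p) ^ n))"
    by (rule sums_summable)
  fix n
  have "p * (1 - p) ^ n * hop_integral v lam (p * lam) D (Suc n)
    \<le> p * (1 - p) ^ n * (excess_mean 0 (\<lambda>_. 0) * (2 * real (Suc n) * v\<^sup>2 / lam\<^sup>2))"
    using p_pos p_le_1 by (intro mult_left_mono hop_integral_le) auto
  also have "\<dots> = p * ?C * (real (Suc n) * (1 - p) ^ n)"
    by (simp add: mult_ac)
  finally show "norm (p * (1 - p) ^ n * hop_integral v lam (p * lam) D (Suc n)) \<le> p * ?C * (real (Suc n) * (1 - p) ^ n)"
    using p_pos p_le_1 hop_integral_nonneg[of "Suc n" v] by (simp add: abs_mult)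
qed

text \<open>With \<open>k = n + 1\<close> the weighted series of \<open>k\<close> and of
  \<open>k * (k - 1)\<close> are the geometric moments \<open>1 / p\<close> and
  \<open>2 * (1 - p) / p^2\<close>.\<close>

lemma cost_mean_sums:
  "(\<lambda>n. p * (1 - p) ^ n * cost_mean v (Suc n)) sums
    (2 * v\<^sup>2 / (p * lam ^ 3) + 2 * v\<^sup>2 * (1 - p) / (p\<^sup>2 * lam ^ 3) + 2 * v\<^sup>2 * D / (p * lam\<^sup>2)
      + (\<Sum>n. p * (1 - p) ^ n * hop_integral v lam (p * lam) D (Suc n)))"
proof -
  have q: "norm (1 - p) < 1"
    using p_pos p_le_1 by simp
  let ?c = "2 * v\<^sup>2 / lam ^ 3 + 2 * v\<^sup>2 * D / lam\<^sup>2"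
  have "(\<lambda>n. p * ?c * (real (Suc n) * (1 - p) ^ n) + p * (v\<^sup>2 / lam ^ 3) * (real (Suc n) * real n * (1 - p) ^ n)
      + p * (1 - p) ^ n * hop_integral v lam (p * lam) D (Suc n)) sums
    (p * ?c * (1 / (1 - (1 - p))\<^sup>2) + p * (v\<^sup>2 / lam ^ 3) * (2 * (1 - p) / (1 - (1 - p)) ^ 3)
      + (\<Sum>n. p * (1 - p) ^ n * hop_integral v lam (p * lam) D (Suc n)))"
    by (intro sums_add sums_mult geometric_deriv_sums sums_Suc_power q summable_sums summable_hop_integral)
  moreover have "p * ?c * (real (Suc n) * (1 - p) ^ n) + p * (v\<^sup>2 / lam ^ 3) * (real (Suc n) * real n * (1 - p) ^ n)
      + p * (1 - p) ^ n * hop_integral v lam (p * lam) D (Suc n) = p * (1 - p) ^ n * cost_mean v (Suc n)" for n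
    by (simp add: cost_mean_def ring_distribs add_divide_distrib mult_ac)
  moreover have "p * ?c * (1 / (1 - (1 - p))\<^sup>2) + p * (v\<^sup>2 / lam ^ 3) * (2 * (1 - p) / (1 - (1 - p)) ^ 3)
    = 2 * v\<^sup>2 / (p * lam ^ 3) + 2 * v\<^sup>2 * (1 - p) / (p\<^sup>2 * lam ^ 3) + 2 * v\<^sup>2 * D / (p * lam\<^sup>2)"
    using p_pos lam_pos by (simp add: field_simps power2_eq_square power3_eq_cube)
  ultimately show ?thesis
    by (simp only:)
qed

lemma has_bochner_integral_cycle_cost:
  "has_bochner_integral M (cycle_cost v D U K Y)
    (2 * v\<^sup>2 / (p * lam ^ 3) + 2 * v\<^sup>2 * (1 - p) / (p\<^sup>2 * lam ^ 3) + 2 * v\<^sup>2 * D / (p * lam\<^sup>2)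
      + (\<Sum>n. p * (1 - p) ^ n * hop_integral v lam (p * lam) D (Suc n)))"
  (is "has_bochner_integral _ _ ?Q")
proof (rule has_bochner_integral_nn_integral)
  have "(\<lambda>\<omega>. (\<lambda>k \<omega>. cost v k (U \<omega>) (hops \<omega>)) (K \<omega>) \<omega>) \<in> borel_measurable M"
    by (rule measurable_compose_countable) measurable
  then show "cycle_cost v D U K Y \<in> borel_measurable M"
    by (simp add: cycle_cost_eq[abs_def])
  show "AE \<omega> in M. 0 \<le> cycle_cost v D U K Y \<omega>"
    using AE_cost_nonneg[of v] by eventually_elim (simp add: cycle_cost_eq)
  have terms_nonneg: "0 \<le> p * (1 - p) ^ n * cost_mean v (Suc n)" for n
    using p_pos p_le_1 cost_mean_nonneg[of "Suc n"] by simp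
  then show "0 \<le> ?Q"
    using sums_le[OF _ sums_zero cost_mean_sums] by blast
  have cost: "(\<integral>\<^sup>+\<omega>. ennreal (cost v (Suc n) (U \<omega>) (hops \<omega>)) \<partial>M) = ennreal (cost_mean v (Suc n))" for n
  proof -
    have "AE \<omega> in M. 0 \<le> cost v (Suc n) (U \<omega>) (hops \<omega>)"
      using AE_cost_nonneg[of v] by eventually_elim blast
    then show ?thesis
      using has_bochner_integral_cost[of "Suc n" v]
      by (simp add: has_bochner_integral_iff nn_integral_eq_integral)
  qed
  have "(\<integral>\<^sup>+\<omega>. ennreal (cycle_cost v D U K Y \<omega>) \<partial>M)
    = (\<Sum>n. ennreal (p * (1 - p) ^ n) * (\<integral>\<^sup>+\<omega>. ennreal (cost v (Suc n) (U \<omega>) (hops \<omega>)) \<partial>M))"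
    unfolding cycle_cost_eq
    by (rule nn_integral_mixture[of "\<lambda>k u y. ennreal (cost v k u y)"]) measurable
  also have "\<dots> = (\<Sum>n. ennreal (p * (1 - p) ^ n * cost_mean v (Suc n)))"
    unfolding cost using p_pos p_le_1 by (simp add: ennreal_mult')
  also have "\<dots> = ennreal ?Q"
    by (rule suminf_ennreal_eq[OF terms_nonneg cost_mean_sums])
  finally show "(\<integral>\<^sup>+\<omega>. ennreal (cycle_cost v D U K Y \<omega>) \<partial>M) = ennreal ?Q" .
qed

end

theorem theorem4:
  fixes M :: "'a measure"
    and v lam mu p D \<rho> \<kappa> :: real
    and U :: "'a \<Rightarrow> real"
    and K :: "'a \<Rightarrow> nat"
    and Y :: "nat \<Rightarrow> 'a \<Rightarrow> real"
  assumes "prob_space M"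
    and "v > 0" and "lam > 0" and "mu > 0" and "0 < p" and "p \<le> 1"
    and D: "D = 1 / mu"
    and rho: "\<rho> = p * lam / mu" and "\<rho> < 1"
    and kappa: "\<kappa> = 1 \<or> (\<exists>\<epsilon>>0. \<kappa> = \<epsilon>\<^sup>2 / 3)"
    and hops_indep: "prob_space.indep_vars M (\<lambda>_. borel) Y {1..}"
    and hops_exponential: "\<And>j. j \<ge> 1 \<Longrightarrow> distributed M lborel (Y j) (exponential_density lam)"
    and K_geometric: "\<And>n. n \<ge> 1 \<Longrightarrow> measure M {\<omega> \<in> space M. K \<omega> = n} = p * (1 - p) ^ (n - 1)"
    and K_indep: "indep_rv M
        (count_space UNIV) K
        (\<Pi>\<^sub>M j\<in>{1..}. borel) (\<lambda>\<omega>. \<lambda>j\<in>{1..}. Y j \<omega>)"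
    and U_indep: "indep_rv M
        borel U
        (count_space UNIV \<Otimes>\<^sub>M (\<Pi>\<^sub>M j\<in>{1..}. borel)) (\<lambda>\<omega>. (K \<omega>, \<lambda>j\<in>{1..}. Y j \<omega>))"
    and steady_state: "distr M borel (system_time D U K Y) = distr M borel U"
  shows "(\<forall>w\<ge>0. measure M {\<omega> \<in> space M. waiting_time U K Y \<omega> \<le> w} = md1_wait_cdf (p * lam) D w
              \<and> md1_wait_cdf (p * lam) D w = md1_wait_pdf_integral (p * lam) D (\<lambda>_. 1) w)
    \<and> integrable M (cycle_cost v D U K Y)
    \<and> (\<forall>k\<ge>1. set_integrable (\<Pi>\<^sub>M j\<in>{1..k}. lborel) (\<Pi>\<^sub>E j\<in>{1..k}. {0..})
                (hop_integrand v lam (p * lam) D k))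
    \<and> summable (\<lambda>n. p * (1 - p) ^ n * hop_integral v lam (p * lam) D (Suc n))
    \<and> (LINT \<omega>|M. cycle_cost v D U K Y \<omega>) =
          2 * v\<^sup>2 / (p * lam ^ 3) + 2 * v\<^sup>2 * (1 - p) / (p\<^sup>2 * lam ^ 3) + 2 * v\<^sup>2 * D / (p * lam\<^sup>2)
        + (\<Sum>n. p * (1 - p) ^ n * hop_integral v lam (p * lam) D (Suc n))
    \<and> age_of_positioning M p \<kappa> lam v D U K Y =
        p * \<kappa> * lam *
         (2 * v\<^sup>2 / (p * lam ^ 3) + 2 * v\<^sup>2 * (1 - p) / (p\<^sup>2 * lam ^ 3) + 2 * v\<^sup>2 * D / (p * lam\<^sup>2)
        + (\<Sum>n. p * (1 - p) ^ n * hop_integral v lam (p * lam) D (Suc n)))"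
proof -
  have D_pos: "0 < D"
    using D \<open>mu > 0\<close> by simp
  have "p * lam * D < 1"
    using D rho \<open>\<rho> < 1\<close> by simp
  then interpret polling_cycle M lam p D U K Y
    using assms(1,3,5,6) D_pos hops_indep hops_exponential K_geometric K_indep U_indep steady_state
    by (intro polling_cycle.intro polling_cycle_axioms.intro) auto
  have "measure M {\<omega> \<in> space M. waiting_time U K Y \<omega> \<le> w} = md1_wait_cdf (p * lam) D w
      \<and> md1_wait_cdf (p * lam) D w = md1_wait_pdf_integral (p * lam) D (\<lambda>_. 1) w" if "0 \<le> w" for w
    using md1.cdf_eq_md1_wait_pdf_integral[OF that] F_eq[of w] md1.F_eq_cdf by simp
  moreover note has_bochner_integral_cycle_cost[of v, unfolded has_bochner_integral_iff]
    set_integrable_hop_integrand[of _ v] summable_hop_integral[of v]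
  ultimately show ?thesis
    unfolding age_of_positioning_def by simp
qed

end
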